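(* Let $A$ be a finite abelian group of even order and exponent at least $3$, let $y\in A$ be an element of order $2$, and let $\mathrm{Dic}(A,y)=\langle A,x \mid x^2=y,\ xax^{-1}=a^{-1}\ (a\in A)\rangle$ be the generalized dicyclic group. Let $S\subseteq \mathrm{Dic}(A,y)$ with $1\notin S$ and $S^{-1}=S$, and write $S=S_1\cup xS_2$ with $S_1,S_2\subseteq A$. Then the Cayley graph $\mathrm{Cay}(\mathrm{Dic}(A,y),S)$ is integral if and only if the following two conditions hold: (1) $S_1\in B(A)$; (2) for every one-dimensional representation $\pi:A\to\mathbb{C}^*$ with $A^2\not\subseteq\ker(\pi)$, there exists $\alpha\in\mathbb{Z}$ such that $\pi(S_2)\,\pi(S_2^{-1})=\alpha^2$.
   Context: Every element of $\mathrm{Dic}(A,y)$ is uniquely of the form $a$ or $xa$ with $a\in A$, and $|\mathrm{Dic}(A,y)|=2|A|$. $A^2=\{a^2: a\in A\}$. For a subset $T$ of a group $G$, $T^{-1}=\{t^{-1}:t\in T\}$. For a finite set $T$ and a function $f$ on $T$, $f(T)=\sum_{t\in T}f(t)$. The Cayley graph $\mathrm{Cay}(G,S)$ (for $1\notin S=S^{-1}$) has vertex set $G$ and edges $\{g,h\}$ with $g^{-1}h\in S$. A graph is integral if all eigenvalues of its adjacency matrix are integers. For a finite abelian group $A$, $B(A)$ (the Boolean algebra of $A$) is the collection of all subsets of $A$ obtained from subgroups of $A$ by finitely many intersections, unions and complements. *)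

theory Defs
  imports
    "Jordan_Normal_Form.Char_Poly"
    "HOL-Algebra.Multiplicative_Group"
begin

definition group_exponent :: "('a, 'm) monoid_scheme \<Rightarrow> nat" where
  "group_exponent G = (LEAST n. 0 < n \<and> (\<forall>a\<in>carrier G. a [^]\<^bsub>G\<^esub> n = \<one>\<^bsub>G\<^esub>))"

text \<open>
  The generalized dicyclic group. The normal form of its elements is built in: \<open>Inl a\<close> stands
  for \<open>a\<close> and \<open>Inr a\<close> for \<open>x a\<close>. The products are the ones forced by
  \<open>a x = x a\<^sup>-\<^sup>1\<close> and \<open>x\<^sup>2 = y\<close>. The lemmas below show that this group is generated by \<open>A\<close>
  and \<open>x\<close>, satisfies the defining relations, and has the universal property of the presentation.
\<close>

fun dic_mult :: "('a, 'm) monoid_scheme \<Rightarrow> 'a \<Rightarrow> 'a + 'a \<Rightarrow> 'a + 'a \<Rightarrow> 'a + 'a" where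
  "dic_mult A y (Inl a) (Inl b) = Inl (a \<otimes>\<^bsub>A\<^esub> b)"
| "dic_mult A y (Inl a) (Inr b) = Inr (inv\<^bsub>A\<^esub> a \<otimes>\<^bsub>A\<^esub> b)"
| "dic_mult A y (Inr a) (Inl b) = Inr (a \<otimes>\<^bsub>A\<^esub> b)"
| "dic_mult A y (Inr a) (Inr b) = Inl (y \<otimes>\<^bsub>A\<^esub> (inv\<^bsub>A\<^esub> a \<otimes>\<^bsub>A\<^esub> b))"

definition Dic :: "('a, 'm) monoid_scheme \<Rightarrow> 'a \<Rightarrow> ('a + 'a) monoid" where
  "Dic A y = \<lparr>carrier = Inl ` carrier A \<union> Inr ` carrier A, monoid.mult = dic_mult A y, one = Inl \<one>\<^bsub>A\<^esub>\<rparr>"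

definition dic_emb :: "'a \<Rightarrow> 'a + 'a" where
  "dic_emb a = Inl a"

definition dic_x :: "('a, 'm) monoid_scheme \<Rightarrow> 'a + 'a" where
  "dic_x A = Inr \<one>\<^bsub>A\<^esub>"

lemma order_Dic:
  assumes "finite (carrier A)"
  shows "order (Dic A y) = 2 * order A"
  using assms 
  by (subst order_def, simp add: Dic_def, subst card_Un_disjoint)
     (auto simp: card_image order_def)

context
  fixes A :: "('a, 'm) monoid_scheme" (structure) and y :: 'a
  assumes A: "comm_group A" and y: "y \<in> carrier A" and yy: "y \<otimes> y = \<one>"
begin

interpretation comm_group A by (rule A)

lemma inv_y: "inv y = y"
  using y yy by (simp add: inv_equality)

lemma group_Dic: "group (Dic A y)"
proof (rule groupI)
  fix u v assume "u \<in> carrier (Dic A y)" "v \<in> carrier (Dic A y)"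
  then show "u \<otimes>\<^bsub>Dic A y\<^esub> v \<in> carrier (Dic A y)"
    using y by (auto simp: Dic_def)
next
  show "\<one>\<^bsub>Dic A y\<^esub> \<in> carrier (Dic A y)" by (auto simp: Dic_def)
next
  fix u v w
  assume "u \<in> carrier (Dic A y)" "v \<in> carrier (Dic A y)" "w \<in> carrier (Dic A y)"
  then show "u \<otimes>\<^bsub>Dic A y\<^esub> v \<otimes>\<^bsub>Dic A y\<^esub> w = u \<otimes>\<^bsub>Dic A y\<^esub> (v \<otimes>\<^bsub>Dic A y\<^esub> w)"
    using y by (auto simp: Dic_def inv_mult inv_y m_ac)
next
  fix u assume "u \<in> carrier (Dic A y)"
  then show "\<one>\<^bsub>Dic A y\<^esub> \<otimes>\<^bsub>Dic A y\<^esub> u = u" by (auto simp: Dic_def)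
next
  fix u assume u: "u \<in> carrier (Dic A y)"
  show "\<exists>v\<in>carrier (Dic A y). v \<otimes>\<^bsub>Dic A y\<^esub> u = \<one>\<^bsub>Dic A y\<^esub>"
  proof (cases u)
    case (Inl a)
    then show ?thesis using u by (intro bexI[of _ "Inl (inv a)"]) (auto simp: Dic_def)
  next
    case (Inr a)
    then have a: "a \<in> carrier A" using u by (auto simp: Dic_def)
    have "y \<otimes> (inv (y \<otimes> a) \<otimes> a) = (y \<otimes> y) \<otimes> (inv a \<otimes> a)"
      using a y by (simp add: inv_mult inv_y m_assoc)
    also have "\<dots> = \<one>" using a yy by simp
    finally show ?thesis using Inr a y
      by (intro bexI[of _ "Inr (y \<otimes> a)"]) (auto simp: Dic_def)
  qed
qed

lemma dic_emb_hom: "dic_emb \<in> hom A (Dic A y)"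
  by (auto simp: hom_def Dic_def dic_emb_def)

lemma dic_x_closed: "dic_x A \<in> carrier (Dic A y)"
  by (auto simp: Dic_def dic_x_def)

lemma Dic_normal_form:
  assumes "g \<in> carrier (Dic A y)"
  shows "\<exists>!u. (\<exists>a\<in>carrier A. u = Inl a \<and> g = dic_emb a) \<or>
              (\<exists>a\<in>carrier A. u = Inr a \<and> g = dic_x A \<otimes>\<^bsub>Dic A y\<^esub> dic_emb a)"
  using assms by (auto simp: Dic_def dic_emb_def dic_x_def)

lemma dic_x_square: "dic_x A \<otimes>\<^bsub>Dic A y\<^esub> dic_x A = dic_emb y"
  using y by (simp add: Dic_def dic_emb_def dic_x_def)

lemma inv_dic_x: "inv\<^bsub>Dic A y\<^esub> (dic_x A) = Inr y"
proof -
  interpret D: group "Dic A y" by (rule group_Dic)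
  show ?thesis
    by (rule D.inv_equality) (use y inv_y yy in \<open>auto simp: Dic_def dic_x_def\<close>)
qed

lemma dic_x_conj:
  assumes "a \<in> carrier A"
  shows "dic_x A \<otimes>\<^bsub>Dic A y\<^esub> dic_emb a \<otimes>\<^bsub>Dic A y\<^esub> inv\<^bsub>Dic A y\<^esub> (dic_x A) = dic_emb (inv a)"
proof -
  have "y \<otimes> (inv a \<otimes> y) = (y \<otimes> y) \<otimes> inv a" using assms y by (simp add: m_ac)
  also have "\<dots> = inv a" using assms yy by simp
  finally show ?thesis
    unfolding inv_dic_x using assms by (simp add: Dic_def dic_emb_def dic_x_def)
qed

lemma Dic_generated:
  "generate (Dic A y) (insert (dic_x A) (dic_emb ` carrier A)) = carrier (Dic A y)"
proof
  interpret D: group "Dic A y" by (rule group_Dic)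
  let ?X = "insert (dic_x A) (dic_emb ` carrier A)"
  have X: "?X \<subseteq> carrier (Dic A y)"
    using dic_x_closed dic_emb_hom by (auto simp: hom_def)
  then show "generate (Dic A y) ?X \<subseteq> carrier (Dic A y)"
    by (rule D.generate_incl)
  show "carrier (Dic A y) \<subseteq> generate (Dic A y) ?X"
  proof
    fix g assume "g \<in> carrier (Dic A y)"
    from Dic_normal_form[OF this] obtain a where a: "a \<in> carrier A"
      and "g = dic_emb a \<or> g = dic_x A \<otimes>\<^bsub>Dic A y\<^esub> dic_emb a" by blast
    then show "g \<in> generate (Dic A y) ?X"
      by (metis generate.eng generate.incl imageI insertCI)
  qed
qed

lemma Dic_universal:
  fixes H :: "('b, 'n) monoid_scheme"
  assumes H: "group H" and f: "f \<in> hom A H" and z: "z \<in> carrier H"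
    and zz: "z \<otimes>\<^bsub>H\<^esub> z = f y"
    and conj: "\<And>a. a \<in> carrier A \<Longrightarrow> z \<otimes>\<^bsub>H\<^esub> f a \<otimes>\<^bsub>H\<^esub> inv\<^bsub>H\<^esub> z = inv\<^bsub>H\<^esub> (f a)"
  shows "\<exists>h\<in>hom (Dic A y) H. (\<forall>a\<in>carrier A. h (dic_emb a) = f a) \<and> h (dic_x A) = z \<and>
    (\<forall>k\<in>hom (Dic A y) H. (\<forall>a\<in>carrier A. k (dic_emb a) = f a) \<and> k (dic_x A) = z \<longrightarrow>
       (\<forall>g\<in>carrier (Dic A y). k g = h g))"
proof -
  interpret H: group H by (rule H)
  interpret f: group_hom A H f
    using f by (simp add: group_hom_def group_hom_axioms_def H)
  define h where "h = case_sum f (\<lambda>a. z \<otimes>\<^bsub>H\<^esub> f a)"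
  have swap: "f a \<otimes>\<^bsub>H\<^esub> z = z \<otimes>\<^bsub>H\<^esub> f (inv a)" if a: "a \<in> carrier A" for a
  proof -
    have "z \<otimes>\<^bsub>H\<^esub> f (inv a) \<otimes>\<^bsub>H\<^esub> inv\<^bsub>H\<^esub> z = f a"
      using conj[of "inv a"] a by simp
    then have "f a \<otimes>\<^bsub>H\<^esub> z = z \<otimes>\<^bsub>H\<^esub> f (inv a) \<otimes>\<^bsub>H\<^esub> inv\<^bsub>H\<^esub> z \<otimes>\<^bsub>H\<^esub> z" by simp
    also have "\<dots> = z \<otimes>\<^bsub>H\<^esub> f (inv a)" using a z by (simp add: H.m_assoc)
    finally show ?thesis .
  qed
  have h: "h \<in> hom (Dic A y) H"
  proof (rule homI)
    fix g assume "g \<in> carrier (Dic A y)"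
    then show "h g \<in> carrier H" using z by (auto simp: Dic_def h_def)
  next
    fix u v assume u: "u \<in> carrier (Dic A y)" and v: "v \<in> carrier (Dic A y)"
    have LR: "f (inv a \<otimes> b) = f (inv a) \<otimes>\<^bsub>H\<^esub> f b" if "a \<in> carrier A" "b \<in> carrier A" for a b
      using that by (intro f.hom_mult) auto
    have 1: "z \<otimes>\<^bsub>H\<^esub> f (inv a \<otimes> b) = f a \<otimes>\<^bsub>H\<^esub> (z \<otimes>\<^bsub>H\<^esub> f b)"
      if a: "a \<in> carrier A" and b: "b \<in> carrier A" for a b
    proof -
      have "f a \<otimes>\<^bsub>H\<^esub> (z \<otimes>\<^bsub>H\<^esub> f b) = f a \<otimes>\<^bsub>H\<^esub> z \<otimes>\<^bsub>H\<^esub> f b"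
        using a b z by (simp add: H.m_assoc)
      also have "\<dots> = z \<otimes>\<^bsub>H\<^esub> f (inv a) \<otimes>\<^bsub>H\<^esub> f b" by (simp only: swap[OF a])
      also have "\<dots> = z \<otimes>\<^bsub>H\<^esub> f (inv a \<otimes> b)"
        using a b z by (simp only: LR H.m_assoc f.hom_closed inv_closed)
      finally show ?thesis by simp
    qed
    have 2: "f (y \<otimes> (inv a \<otimes> b)) = z \<otimes>\<^bsub>H\<^esub> f a \<otimes>\<^bsub>H\<^esub> (z \<otimes>\<^bsub>H\<^esub> f b)"
      if a: "a \<in> carrier A" and b: "b \<in> carrier A" for a b
    proof -
      have "z \<otimes>\<^bsub>H\<^esub> f a \<otimes>\<^bsub>H\<^esub> (z \<otimes>\<^bsub>H\<^esub> f b) = z \<otimes>\<^bsub>H\<^esub> (f a \<otimes>\<^bsub>H\<^esub> (z \<otimes>\<^bsub>H\<^esub> f b))"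
        using a b z by (simp add: H.m_assoc)
      also have "\<dots> = z \<otimes>\<^bsub>H\<^esub> (z \<otimes>\<^bsub>H\<^esub> f (inv a \<otimes> b))" by (simp only: 1[OF a b])
      also have "\<dots> = f y \<otimes>\<^bsub>H\<^esub> f (inv a \<otimes> b)"
        unfolding zz[symmetric] using a b z
        by (intro H.m_assoc[symmetric] f.hom_closed m_closed inv_closed) auto
      also have "\<dots> = f (y \<otimes> (inv a \<otimes> b))" using a b y by (intro f.hom_mult[symmetric]) auto
      finally show ?thesis by simp
    qed
    show "h (u \<otimes>\<^bsub>Dic A y\<^esub> v) = h u \<otimes>\<^bsub>H\<^esub> h v"
    proof (cases u)
      case u': (Inl a)
      show ?thesis
      proof (cases v)
        case (Inl b) then show ?thesis using u v u' by (auto simp: Dic_def h_def)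
      next
        case (Inr b) then show ?thesis using u v u' 1 by (auto simp: Dic_def h_def)
      qed
    next
      case u': (Inr a)
      show ?thesis
      proof (cases v)
        case (Inl b) then show ?thesis using u v u' z by (auto simp: Dic_def h_def H.m_assoc)
      next
        case (Inr b) then show ?thesis using u v u' 2 by (auto simp: Dic_def h_def)
      qed
    qed
  qed
  moreover have hx: "h (dic_x A) = z" using z by (simp add: h_def dic_x_def)
  moreover have "k g = h g"
    if k: "k \<in> hom (Dic A y) H" and ka: "\<forall>a\<in>carrier A. k (dic_emb a) = f a"
      and kx: "k (dic_x A) = z" and g: "g \<in> carrier (Dic A y)" for k g
  proof -
    from Dic_normal_form[OF g] obtain a where a: "a \<in> carrier A"
      and "g = dic_emb a \<or> g = dic_x A \<otimes>\<^bsub>Dic A y\<^esub> dic_emb a" by blast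
    moreover have ea: "dic_emb a \<in> carrier (Dic A y)"
      using dic_emb_hom a by (auto simp: hom_def)
    have "k (dic_x A \<otimes>\<^bsub>Dic A y\<^esub> dic_emb a) = z \<otimes>\<^bsub>H\<^esub> f a"
      using hom_mult[OF k dic_x_closed ea] ka kx a by simp
    moreover have "h (dic_x A \<otimes>\<^bsub>Dic A y\<^esub> dic_emb a) = z \<otimes>\<^bsub>H\<^esub> f a"
      using hom_mult[OF h dic_x_closed ea] hx a by (simp add: h_def dic_emb_def)
    ultimately show ?thesis using ka by (auto simp: h_def dic_emb_def)
  qed
  ultimately show ?thesis
    by (intro bexI[of _ h]) (auto simp: h_def dic_emb_def)
qed

end

text \<open>A graph is a pair of a vertex set and a set of edges \<open>{u, v}\<close>.\<close>

type_synonym 'v graph = "'v set \<times> 'v set set"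

definition Cayley_graph :: "('g, 'm) monoid_scheme \<Rightarrow> 'g set \<Rightarrow> 'g graph" where
  "Cayley_graph G S =
     (carrier G,
      {{g, h} | g h. g \<in> carrier G \<and> h \<in> carrier G \<and> inv\<^bsub>G\<^esub> g \<otimes>\<^bsub>G\<^esub> h \<in> S})"

definition adjacency_matrix :: "'v list \<Rightarrow> 'v set set \<Rightarrow> complex mat" where
  "adjacency_matrix vs E =
     mat (length vs) (length vs) (\<lambda>(i, j). if {vs ! i, vs ! j} \<in> E then 1 else 0)"

text \<open>
  Only meaningful for finite graphs. The spectrum does not depend on the enumeration \<open>vs\<close> of the
  vertices.
\<close>

definition integral_graph :: "'v graph \<Rightarrow> bool" where
  "integral_graph \<Gamma> \<longleftrightarrow>
     (\<forall>vs. distinct vs \<and> set vs = fst \<Gamma> \<longrightarrow>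
       (\<forall>k. eigenvalue (adjacency_matrix vs (snd \<Gamma>)) k \<longrightarrow> k \<in> \<int>))"

inductive_set subgroup_algebra :: "('a, 'm) monoid_scheme \<Rightarrow> 'a set set"
  for A :: "('a, 'm) monoid_scheme" where
  subgroup: "subgroup H A \<Longrightarrow> H \<in> subgroup_algebra A"
| inter: "X \<in> subgroup_algebra A \<Longrightarrow> Y \<in> subgroup_algebra A \<Longrightarrow> X \<inter> Y \<in> subgroup_algebra A"
| union: "X \<in> subgroup_algebra A \<Longrightarrow> Y \<in> subgroup_algebra A \<Longrightarrow> X \<union> Y \<in> subgroup_algebra A"
| compl: "X \<in> subgroup_algebra A \<Longrightarrow> carrier A - X \<in> subgroup_algebra A"

definition complex_units :: "complex monoid" where
  "complex_units = \<lparr>carrier = UNIV - {0}, monoid.mult = (*), one = 1\<rparr>"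

definition squares :: "('a, 'm) monoid_scheme \<Rightarrow> 'a set" where
  "squares A = {a [^]\<^bsub>A\<^esub> (2::nat) | a. a \<in> carrier A}"

end

theory Submission
  imports Defs "HOL-Number_Theory.Residues"
begin

text \<open>
  For a character \<open>\<chi>\<close> of \<open>A\<close>, the functions equal to a multiple of \<open>\<chi>\<close> on \<open>A\<close> and to a multiple of
  \<open>x a \<mapsto> \<chi> (a\<^sup>-\<^sup>1)\<close> on \<open>x A\<close> form an invariant plane of the adjacency operator. Since \<open>S\<^sub>1\<close> is closed
  under inversion and \<open>y S\<^sub>2 = S\<^sub>2\<close>, the operator acts there with eigenvalues \<open>\<chi>(S\<^sub>1) \<plusminus> |\<chi>(S\<^sub>2)|\<close>, and by
  Fourier analysis on \<open>A\<close> every eigenvalue has this form. If all of them are integers, then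
  \<open>2 \<chi>(S\<^sub>1)\<close> is an integer; as \<open>\<chi>(S\<^sub>1)\<close> is an algebraic integer, it is an integer, and so is \<open>|\<chi>(S\<^sub>2)|\<close>.
  Characters that are trivial on \<open>A\<^sup>2\<close> take the values \<open>\<plusminus>1\<close>, so they impose no condition on \<open>S\<^sub>2\<close>.

  It remains to see (Bridges and Mena) that \<open>S \<in> B(A)\<close> iff \<open>\<chi>(S)\<close> is an integer for every \<open>\<chi>\<close>. Indicators of
  sets in \<open>B(A)\<close> are integer combinations of indicators of subgroups, which have integral character
  sums. Conversely, integrality makes \<open>S\<close> closed under \<open>s \<mapsto> s\<^sup>p\<close> for all primes \<open>p\<close> not dividing
  \<open>|A|\<close>. Instead of Galois theory this uses only the Frobenius congruence
  \<open>\<chi>(S)\<^sup>p \<equiv> \<chi>({s\<^sup>p | s \<in> S})\<close> modulo \<open>p\<close> and Fourier inversion. Hence \<open>S\<close> is a union of sets of generators of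
  cyclic subgroups.
\<close>

section \<open>Characters of a finite abelian group\<close>

locale finite_comm_group = comm_group A for A (structure) +
  assumes finite_carrier [simp, intro]: "finite (carrier A)"
begin

section \<open>Elementary properties of characters and of the Fourier transform\<close>

lemma order_pos: "order A > 0"
  using order_gt_0_iff_finite by simp

lemma order_neq_0 [simp]: "order A \<noteq> 0"
  using order_pos by simp

text \<open>The argument \<open>\<chi>\<close> may be any function; for a character,
  \<open>\<chi> (inv a)\<close> is the complex conjugate of \<open>\<chi> a\<close>.\<close>

definition fourier :: "('a \<Rightarrow> complex) \<Rightarrow> ('a \<Rightarrow> complex) \<Rightarrow> complex" where
  "fourier f \<chi> = (\<Sum>a\<in>carrier A. f a * \<chi> (inv a))"

lemma char_nonzero: "\<chi> \<in> hom A complex_units \<Longrightarrow> a \<in> carrier A \<Longrightarrow> \<chi> a \<noteq> 0"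
  by (auto simp: hom_def complex_units_def)

lemma char_mult:
  "\<chi> \<in> hom A complex_units \<Longrightarrow> a \<in> carrier A \<Longrightarrow> b \<in> carrier A \<Longrightarrow> \<chi> (a \<otimes> b) = \<chi> a * \<chi> b"
  by (auto simp: hom_def complex_units_def)

lemma char_one: "\<chi> \<in> hom A complex_units \<Longrightarrow> \<chi> \<one> = 1"
  using char_mult[of \<chi> \<one> \<one>] char_nonzero[of \<chi> \<one>] by simp

lemma char_inv: "\<chi> \<in> hom A complex_units \<Longrightarrow> a \<in> carrier A \<Longrightarrow> \<chi> (inv a) = inverse (\<chi> a)"
  using char_mult[of \<chi> a "inv a"] char_one[of \<chi>] by (simp add: inverse_unique)

lemma char_pow:
  "\<chi> \<in> hom A complex_units \<Longrightarrow> a \<in> carrier A \<Longrightarrow> \<chi> (a [^] (k::nat)) = \<chi> a ^ k"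
  by (induction k) (auto simp: char_one char_mult)

lemma char_root_of_unity:
  assumes "\<chi> \<in> hom A complex_units" "a \<in> carrier A"
  shows "\<chi> a ^ order A = 1"
  using char_pow[OF assms, of "order A"] pow_order_eq_1[OF assms(2)] char_one[OF assms(1)] by simp

lemma norm_char:
  assumes "\<chi> \<in> hom A complex_units" "a \<in> carrier A"
  shows "norm (\<chi> a) = 1"
  using char_root_of_unity[OF assms] order_pos by (metis norm_one norm_power power_eq_1_iff norm_ge_zero neq0_conv)

lemma char_inv_cnj:
  assumes "\<chi> \<in> hom A complex_units" "a \<in> carrier A"
  shows "\<chi> (inv a) = cnj (\<chi> a)"
proof -
  have "\<chi> a * cnj (\<chi> a) = 1"
    using norm_char[OF assms] by (simp add: complex_norm_square[symmetric])
  then show ?thesis using char_inv[OF assms] by (simp add: inverse_unique)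
qed

lemma sum_translate:
  assumes "b \<in> carrier A"
  shows "(\<Sum>x\<in>carrier A. f (b \<otimes> x)) = (\<Sum>x\<in>carrier A. f x :: complex)"
proof (rule sum.reindex_bij_witness[of _ "\<lambda>x. inv b \<otimes> x" "\<lambda>x. b \<otimes> x"])
qed (use assms in \<open>auto simp: m_assoc[symmetric]\<close>)

lemma fourier_translate:
  assumes \<chi>: "\<chi> \<in> hom A complex_units" and b: "b \<in> carrier A"
  shows "fourier (\<lambda>x. f (b \<otimes> x)) \<chi> = \<chi> b * fourier f \<chi>"
proof -
  have "fourier (\<lambda>x. f (b \<otimes> x)) \<chi> = (\<Sum>x\<in>carrier A. \<chi> b * (f (b \<otimes> x) * \<chi> (inv (b \<otimes> x))))"
    unfolding fourier_def
    by (intro sum.cong) (use \<chi> b in \<open>auto simp: char_mult char_inv char_nonzero inv_mult\<close>)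
  also have "\<dots> = \<chi> b * fourier f \<chi>"
    using sum_translate[OF b, of "\<lambda>x. f x * \<chi> (inv x)"]
    by (simp add: sum_distrib_left[symmetric] fourier_def)
  finally show ?thesis .
qed

lemma fourier_linear:
  "fourier (\<lambda>x. c * f x + g x) \<chi> = c * fourier f \<chi> + fourier g \<chi>"
  by (simp add: fourier_def sum.distrib sum_distrib_left algebra_simps)

section \<open>Common eigenfunctions of translations\<close>

text \<open>Translations commute and have finite order, so they can be diagonalized simultaneously.
  In the induction on \<open>B\<close>, the current eigenfunction is projected to an eigenspace of
  one further translation and remains an eigenfunction of the earlier ones.\<close>

lemma exists_translation_eigenfunction:
  fixes W :: "('a \<Rightarrow> complex) set"
  assumes zero: "(\<lambda>_. 0) \<in> W"
    and lin: "\<And>c f g. f \<in> W \<Longrightarrow> g \<in> W \<Longrightarrow> (\<lambda>x. c * f x + g x) \<in> W"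
    and transl: "\<And>b f. f \<in> W \<Longrightarrow> b \<in> carrier A \<Longrightarrow> (\<lambda>x. f (b \<otimes> x)) \<in> W"
    and nontriv: "\<exists>f\<in>W. \<exists>x\<in>carrier A. f x \<noteq> 0"
    and B: "finite B" "B \<subseteq> carrier A"
  shows "\<exists>f\<in>W. (\<exists>x\<in>carrier A. f x \<noteq> 0) \<and> (\<forall>b\<in>B. \<exists>c. \<forall>x\<in>carrier A. f (b \<otimes> x) = c * f x)"
  using B
proof (induction B rule: finite_induct)
  case empty
  then show ?case using nontriv by simp
next
  case (insert b B)
  then obtain f x0 where f: "f \<in> W" "x0 \<in> carrier A" "f x0 \<noteq> 0"
    and ev: "\<And>b'. b' \<in> B \<Longrightarrow> \<exists>c. \<forall>x\<in>carrier A. f (b' \<otimes> x) = c * f x"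
    by auto
  have b: "b \<in> carrier A" and B: "B \<subseteq> carrier A" using insert by auto
  define n where "n = order A"
  have n: "n > 0" by (simp add: n_def order_pos)
  have bn: "b [^] n = \<one>" using b by (simp add: n_def pow_order_eq_1)
  define \<omega> where "\<omega> = cis (2 * pi / real n)"
  have \<omega>n: "\<omega> ^ n = 1" using n by (simp add: \<omega>_def DeMoivre)
  have \<omega>0: "\<omega> \<noteq> 0" by (simp add: \<omega>_def)
  have \<omega>j: "\<omega> ^ j \<noteq> 1" if "0 < j" "j < n" for j
  proof
    assume "\<omega> ^ j = 1"
    then have "cis (2 * pi * real j / real n) = cis (2 * pi * real 0 / real n)"
      by (simp add: \<omega>_def DeMoivre mult.commute)
    moreover have "inj_on (\<lambda>k. cis (2 * pi * real k / real n)) {..<n}"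
      using bij_betw_roots_unity[OF n] by (rule bij_betw_imp_inj_on)
    ultimately have "j = 0" using inj_onD[of _ "{..<n}" j 0] that by force
    then show False using that by simp
  qed
  \<comment> \<open>Up to the factor \<open>n\<close>, \<open>F k\<close> is the projection of \<open>f\<close> to an eigenspace of the translation by \<open>b\<close>.\<close>
  define F where "F k x = (\<Sum>j<n. (\<omega> ^ k) ^ j * f (b [^] j \<otimes> x))" for k x
  have FW: "F k \<in> W" for k
  proof -
    have "(\<lambda>x. \<Sum>j<m. (\<omega> ^ k) ^ j * f (b [^] j \<otimes> x)) \<in> W" for m
    proof (induction m)
      case 0 then show ?case using zero by simp
    next
      case (Suc m)
      have "(\<lambda>x. (\<omega> ^ k) ^ m * f (b [^] m \<otimes> x) + (\<Sum>j<m. (\<omega> ^ k) ^ j * f (b [^] j \<otimes> x))) \<in> W"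
        by (intro lin transl f Suc) (use b in auto)
      then show ?case by (simp add: add.commute)
    qed
    then show ?thesis unfolding F_def .
  qed
  \<comment> \<open>The sum over \<open>k\<close> of the powers of \<open>\<omega> ^ j\<close>
    vanishes unless \<open>j = 0\<close>, so the projections add up to \<open>n\<close> times
    \<open>f\<close>. Hence one of them is nonzero at \<open>x0\<close>.\<close>
  have Fsum: "(\<Sum>k<n. F k x) = of_nat n * f x" if x: "x \<in> carrier A" for x
  proof -
    have "(\<Sum>k<n. F k x) = (\<Sum>j<n. (\<Sum>k<n. (\<omega> ^ j) ^ k) * f (b [^] j \<otimes> x))"
      unfolding F_def sum_distrib_right
      by (subst sum.swap) (simp add: power_mult[symmetric] mult.commute[of _ "_ :: nat"])
    also have "\<dots> = (\<Sum>j<n. if j = 0 then of_nat n * f x else 0)"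
    proof (intro sum.cong refl)
      fix j assume j: "j \<in> {..<n}"
      show "(\<Sum>k<n. (\<omega> ^ j) ^ k) * f (b [^] j \<otimes> x) = (if j = 0 then of_nat n * f x else 0)"
      proof (cases "j = 0")
        case True then show ?thesis using x by simp
      next
        case False
        have "(\<omega> ^ j) ^ n = 1" using \<omega>n by (metis mult.commute power_mult power_one)
        then have "(\<Sum>k<n. (\<omega> ^ j) ^ k) = 0"
          using geometric_sum[OF \<omega>j] False j by simp
        then show ?thesis using False by simp
      qed
    qed
    also have "\<dots> = of_nat n * f x" using n by simp
    finally show ?thesis .
  qed
  have "\<exists>k<n. F k x0 \<noteq> 0"
  proof (rule ccontr)
    assume "\<not> ?thesis"
    then have "(\<Sum>k<n. F k x0) = 0" by simp
    then show False using Fsum[OF f(2)] f(3) n by simp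
  qed
  then obtain k where k: "F k x0 \<noteq> 0" by blast
  \<comment> \<open>Translation by \<open>b\<close> shifts the summation index by one, and the sum
    is cyclic because \<open>h n = h 0\<close>.\<close>
  have Fb: "F k (b \<otimes> x) = inverse (\<omega> ^ k) * F k x" if x: "x \<in> carrier A" for x
  proof -
    define h where "h j = (\<omega> ^ k) ^ j * f (b [^] j \<otimes> x)" for j
    have "(\<omega> ^ k) ^ n = 1" using \<omega>n by (metis mult.commute power_mult power_one)
    then have hn: "h n = h 0" by (simp add: h_def bn)
    have "\<omega> ^ k * F k (b \<otimes> x) = (\<Sum>j<n. h (Suc j))"
      unfolding F_def h_def sum_distrib_left
      by (intro sum.cong) (use b x in \<open>auto simp: m_assoc\<close>)
    also have "\<dots> = (\<Sum>j<n. h j)"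
      using sum.lessThan_Suc_shift[of h n] sum.lessThan_Suc[of h n] hn by simp
    also have "\<dots> = F k x" by (simp add: F_def h_def)
    finally show ?thesis using \<omega>0 by (simp add: field_simps)
  qed
  have "\<exists>c. \<forall>x\<in>carrier A. F k (b' \<otimes> x) = c * F k x" if b': "b' \<in> B" for b'
  proof -
    obtain c where c: "\<And>x. x \<in> carrier A \<Longrightarrow> f (b' \<otimes> x) = c * f x" using ev[OF b'] by auto
    have "F k (b' \<otimes> x) = c * F k x" if x: "x \<in> carrier A" for x
      unfolding F_def sum_distrib_left
    proof (intro sum.cong refl)
      fix j :: nat
      have "b [^] j \<otimes> (b' \<otimes> x) = b' \<otimes> (b [^] j \<otimes> x)"
        using b B b' x by (intro m_lcomm) auto
      then show "(\<omega> ^ k) ^ j * f (b [^] j \<otimes> (b' \<otimes> x)) = c * ((\<omega> ^ k) ^ j * f (b [^] j \<otimes> x))"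
        using c[of "b [^] j \<otimes> x"] b x by simp
    qed
    then show ?thesis by blast
  qed
  then show ?case using FW[of k] k f(2) Fb by (intro bexI[of _ "F k"]) auto
qed

text \<open>
  The functions with vanishing Fourier transform form a translation-invariant space; if it were
  nonzero, it would contain a common eigenfunction of all translations, that is, a character.
\<close>

theorem fourier_injective:
  assumes "\<And>\<chi>. \<chi> \<in> hom A complex_units \<Longrightarrow> fourier f \<chi> = 0" and "a \<in> carrier A"
  shows "f a = 0"
proof (rule ccontr)
  assume fa: "f a \<noteq> 0"
  define W where "W = {f. \<forall>\<chi>\<in>hom A complex_units. fourier f \<chi> = 0}"
  have "\<exists>f\<in>W. (\<exists>x\<in>carrier A. f x \<noteq> 0) \<and>
      (\<forall>b\<in>carrier A. \<exists>c. \<forall>x\<in>carrier A. f (b \<otimes> x) = c * f x)"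
  proof (rule exists_translation_eigenfunction)
    show "(\<lambda>_. 0) \<in> W" by (simp add: W_def fourier_def)
    show "\<exists>f\<in>W. \<exists>x\<in>carrier A. f x \<noteq> 0" using assms fa by (auto simp: W_def)
  qed (auto simp: W_def fourier_linear fourier_translate)
  then obtain g x0 where g: "g \<in> W" "x0 \<in> carrier A" "g x0 \<noteq> 0"
    and ex: "\<And>b. b \<in> carrier A \<Longrightarrow> \<exists>c. \<forall>x\<in>carrier A. g (b \<otimes> x) = c * g x"
    by auto
  obtain \<chi> where \<chi>: "\<And>b x. b \<in> carrier A \<Longrightarrow> x \<in> carrier A \<Longrightarrow> g (b \<otimes> x) = \<chi> b * g x"
    using ex by metis
  have gone: "g x = \<chi> x * g \<one>" if "x \<in> carrier A" for x using \<chi>[OF that, of \<one>] that by simp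
  have g1: "g \<one> \<noteq> 0" using gone[OF g(2)] g(3) by auto
  have hom: "\<chi> \<in> hom A complex_units"
  proof (rule homI)
    fix b c assume bc: "b \<in> carrier A" "c \<in> carrier A"
    have "\<chi> (b \<otimes> c) * g \<one> = \<chi> b * \<chi> c * g \<one>"
      using gone[of "b \<otimes> c"] \<chi>[of b c] gone[of c] bc by (metis m_closed mult.assoc)
    then show "\<chi> (b \<otimes> c) = \<chi> b \<otimes>\<^bsub>complex_units\<^esub> \<chi> c"
      using g1 by (simp add: complex_units_def)
  next
    fix b assume b: "b \<in> carrier A"
    have "g \<one> = \<chi> b * g (inv b)" using \<chi>[of b "inv b"] b by simp
    then show "\<chi> b \<in> carrier complex_units" using g1 by (auto simp: complex_units_def)
  qed
  \<comment> \<open>All summands equal \<open>g \<one>\<close>, so the transform at the character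
    \<open>\<chi>\<close> is nonzero, contradicting \<open>g \<in> W\<close>.\<close>
  have "fourier g \<chi> = (\<Sum>x\<in>carrier A. g \<one>)"
    unfolding fourier_def
  proof (intro sum.cong refl)
    fix x assume x: "x \<in> carrier A"
    show "g x * \<chi> (inv x) = g \<one>"
      unfolding gone[OF x] using hom x by (simp add: char_inv char_nonzero)
  qed
  also have "\<dots> = of_nat (order A) * g \<one>" by (simp add: order_def)
  finally show False using g(1) hom g1 order_pos by (auto simp: W_def)
qed

section \<open>Orthogonality relations and Fourier inversion\<close>

text \<open>Elements of \<open>hom A complex_units\<close> are arbitrary outside
  \<open>carrier A\<close>. Extensionality picks one representative of each character, so that sums
  over the dual group make sense.\<close>

definition characters :: "('a \<Rightarrow> complex) set" where
  "characters = hom A complex_units \<inter> extensional (carrier A)"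

lemma characters_hom: "\<chi> \<in> characters \<Longrightarrow> \<chi> \<in> hom A complex_units"
  by (simp add: characters_def)

lemma restrict_character:
  "\<chi> \<in> hom A complex_units \<Longrightarrow> restrict \<chi> (carrier A) \<in> characters"
  by (auto simp: characters_def hom_def)

lemma finite_characters: "finite characters"
proof (rule finite_subset)
  show "characters \<subseteq> carrier A \<rightarrow>\<^sub>E {z. z ^ order A = 1}"
    using char_root_of_unity by (auto simp: characters_def PiE_def)
  show "finite (carrier A \<rightarrow>\<^sub>E {z::complex. z ^ order A = 1})"
    using order_pos by (intro finite_PiE finite_roots_unity) (auto simp: Suc_le_eq)
qed

lemma sum_character:
  assumes \<chi>: "\<chi> \<in> hom A complex_units"
  shows "(\<Sum>a\<in>carrier A. \<chi> a) = (if \<forall>a\<in>carrier A. \<chi> a = 1 then of_nat (order A) else 0)"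
proof (cases "\<forall>a\<in>carrier A. \<chi> a = 1")
  case True
  then show ?thesis by (simp add: order_def)
next
  case False
  then obtain b where b: "b \<in> carrier A" "\<chi> b \<noteq> 1" by auto
  have "\<chi> b * (\<Sum>a\<in>carrier A. \<chi> a) = (\<Sum>a\<in>carrier A. \<chi> (b \<otimes> a))"
    using b \<chi> by (simp add: sum_distrib_left char_mult)
  also have "\<dots> = (\<Sum>a\<in>carrier A. \<chi> a)" by (rule sum_translate[OF b(1)])
  finally show ?thesis using b(2) False by auto
qed

text \<open>Otherwise the point masses at \<open>a\<close> and at \<open>\<one>\<close> would have
  the same Fourier transform, against injectivity.\<close>

lemma character_separates:
  assumes a: "a \<in> carrier A" "a \<noteq> \<one>"
  shows "\<exists>\<chi>\<in>characters. \<chi> a \<noteq> 1"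
proof (rule ccontr)
  assume "\<not> ?thesis"
  then have 1: "\<chi> a = 1" if "\<chi> \<in> hom A complex_units" for \<chi>
    using restrict_character[OF that] a(1) by force
  define f where "f x = (if x = a then 1 else 0) - (if x = \<one> then 1 else 0 :: complex)" for x
  have "f a = 0"
  proof (rule fourier_injective[OF _ a(1)])
    fix \<chi> assume \<chi>: "\<chi> \<in> hom A complex_units"
    have "fourier f \<chi> = (\<Sum>x\<in>carrier A. if x = a then \<chi> (inv x) else 0) -
        (\<Sum>x\<in>carrier A. if x = \<one> then \<chi> (inv x) else 0)"
      unfolding fourier_def f_def sum_subtractf[symmetric] by (intro sum.cong) auto
    also have "\<dots> = \<chi> (inv a) - \<chi> (inv \<one>)" using a(1) by simp
    also have "\<dots> = 0" using \<chi> a(1) 1[OF \<chi>] by (simp add: char_inv char_one)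
    finally show "fourier f \<chi> = 0" .
  qed
  then show False using a by (simp add: f_def)
qed

text \<open>Multiplication by a character \<open>\<psi>\<close> with
  \<open>\<psi> a \<noteq> 1\<close> permutes the characters, so the sum is unchanged by the factor
  \<open>\<psi> a\<close>.\<close>

lemma sum_characters_neq_one:
  assumes a: "a \<in> carrier A" "a \<noteq> \<one>"
  shows "(\<Sum>\<chi>\<in>characters. \<chi> a) = 0"
proof -
  obtain \<psi> where \<psi>: "\<psi> \<in> characters" "\<psi> a \<noteq> 1" using character_separates[OF a] by auto
  have \<psi>h: "\<psi> \<in> hom A complex_units" using \<psi> by (simp add: characters_def)
  have "(\<Sum>\<chi>\<in>characters. \<psi> a * \<chi> a) = (\<Sum>\<chi>\<in>characters. \<chi> a)"
  proof (rule sum.reindex_bij_witness[of _ "\<lambda>\<chi>. \<lambda>x\<in>carrier A. inverse (\<psi> x) * \<chi> x"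
        "\<lambda>\<chi>. \<lambda>x\<in>carrier A. \<psi> x * \<chi> x"])
    fix \<chi> assume "\<chi> \<in> characters"
    then have \<chi>: "\<chi> \<in> hom A complex_units" "\<chi> \<in> extensional (carrier A)"
      by (auto simp: characters_def)
    show "(\<lambda>x\<in>carrier A. inverse (\<psi> x) * (\<lambda>x\<in>carrier A. \<psi> x * \<chi> x) x) = \<chi>"
         "(\<lambda>x\<in>carrier A. \<psi> x * (\<lambda>x\<in>carrier A. inverse (\<psi> x) * \<chi> x) x) = \<chi>"
      using \<chi>(2) char_nonzero[OF \<psi>h]
      by (auto intro!: extensionalityI[OF restrict_extensional \<chi>(2)])
    show "(\<lambda>x\<in>carrier A. \<psi> x * \<chi> x) \<in> characters"
      "(\<lambda>x\<in>carrier A. inverse (\<psi> x) * \<chi> x) \<in> characters"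
      using char_nonzero[OF \<psi>h] char_nonzero[OF \<chi>(1)] char_mult[OF \<psi>h] char_mult[OF \<chi>(1)]
      by (auto simp: characters_def hom_def complex_units_def)
  qed (use a in auto)
  then have "\<psi> a * (\<Sum>\<chi>\<in>characters. \<chi> a) = (\<Sum>\<chi>\<in>characters. \<chi> a)"
    by (simp add: sum_distrib_left)
  then show ?thesis using \<psi>(2) by auto
qed

text \<open>The double sum of \<open>\<chi> a\<close> is computed in two ways: summing over
  \<open>\<chi>\<close> first leaves only \<open>a = \<one>\<close>, summing over \<open>a\<close>
  first leaves only the trivial character.\<close>

lemma card_characters: "card characters = order A"
proof -
  have "of_nat (card characters) = (\<Sum>a\<in>carrier A. if a = \<one> then of_nat (card characters) else 0 :: complex)"
    by simp
  also have "\<dots> = (\<Sum>a\<in>carrier A. \<Sum>\<chi>\<in>characters. \<chi> a)"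
    by (intro sum.cong refl) (auto simp: sum_characters_neq_one char_one[OF characters_hom])
  also have "\<dots> = (\<Sum>\<chi>\<in>characters. \<Sum>a\<in>carrier A. \<chi> a)" by (rule sum.swap)
  also have "\<dots> = (\<Sum>\<chi>\<in>characters. if \<chi> = (\<lambda>a\<in>carrier A. 1) then of_nat (order A) else 0)"
  proof (intro sum.cong refl)
    fix \<chi> assume \<chi>: "\<chi> \<in> characters"
    then have "(\<forall>a\<in>carrier A. \<chi> a = 1) \<longleftrightarrow> \<chi> = (\<lambda>a\<in>carrier A. 1)"
      by (auto simp: characters_def intro!: extensionalityI[of \<chi> "carrier A"])
    then show "(\<Sum>a\<in>carrier A. \<chi> a) = (if \<chi> = (\<lambda>a\<in>carrier A. 1) then of_nat (order A) else 0)"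
      using sum_character[OF characters_hom[OF \<chi>]] by simp
  qed
  also have "\<dots> = of_nat (order A)"
  proof -
    have "(\<lambda>a\<in>carrier A. 1) \<in> characters"
      by (auto simp: characters_def hom_def complex_units_def)
    then show ?thesis using finite_characters by simp
  qed
  finally show ?thesis using of_nat_eq_iff by blast
qed

theorem fourier_inversion:
  assumes a: "a \<in> carrier A"
  shows "(\<Sum>\<chi>\<in>characters. fourier f \<chi> * \<chi> a) = of_nat (order A) * f a"
proof -
  have "(\<Sum>\<chi>\<in>characters. fourier f \<chi> * \<chi> a) = (\<Sum>\<chi>\<in>characters. \<Sum>x\<in>carrier A. f x * \<chi> (inv x \<otimes> a))"
    unfolding fourier_def sum_distrib_right
    by (intro sum.cong refl) (use a in \<open>auto simp: char_mult[OF characters_hom]\<close>)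
  also have "\<dots> = (\<Sum>x\<in>carrier A. f x * (\<Sum>\<chi>\<in>characters. \<chi> (inv x \<otimes> a)))"
    by (subst sum.swap) (simp add: sum_distrib_left)
  also have "\<dots> = (\<Sum>x\<in>carrier A. if x = a then of_nat (order A) * f a else 0)"
  proof (intro sum.cong refl)
    fix x assume x: "x \<in> carrier A"
    show "f x * (\<Sum>\<chi>\<in>characters. \<chi> (inv x \<otimes> a)) = (if x = a then of_nat (order A) * f a else 0)"
    proof (cases "x = a")
      case True
      then show ?thesis using a by (simp add: char_one[OF characters_hom] card_characters)
    next
      case False
      then have "inv x \<otimes> a \<noteq> \<one>" using a x by (metis inv_equality inv_inv inv_closed)
      then show ?thesis using False a x by (simp add: sum_characters_neq_one)
    qed
  qed
  also have "\<dots> = of_nat (order A) * f a" using a by simp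
  finally show ?thesis .
qed

end

section \<open>Integers adjoined a root of unity\<close>

text \<open>The number \<open>z\<close> is a root of the characteristic polynomial of the integer
  matrix \<open>c\<close>, which is monic with integer coefficients.\<close>

lemma algebraic_int_if_int_eigenvalue:
  fixes v :: "nat \<Rightarrow> complex" and c :: "nat \<Rightarrow> nat \<Rightarrow> int"
  assumes ev: "\<And>i. i < n \<Longrightarrow> z * v i = (\<Sum>j<n. of_int (c i j) * v j)"
    and nz: "i0 < n" "v i0 \<noteq> 0"
  shows "algebraic_int z"
proof -
  define M where "M = mat n n (\<lambda>(i, j). c i j)"
  define M' where "M' = map_mat complex_of_int M"
  have M: "M \<in> carrier_mat n n" and M': "M' \<in> carrier_mat n n" by (auto simp: M_def M'_def)
  have "eigenvector M' (vec n v) z"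
    unfolding eigenvector_def
  proof (intro conjI)
    show "vec n v \<in> carrier_vec (dim_row M')" using M' by auto
    show "vec n v \<noteq> 0\<^sub>v (dim_row M')"
      using M' nz by (metis carrier_matD(1) index_vec index_zero_vec(1))
    show "M' *\<^sub>v vec n v = z \<cdot>\<^sub>v vec n v"
      by (rule eq_vecI) (auto simp: M'_def M_def scalar_prod_def ev atLeast0LessThan)
  qed
  then have "poly (char_poly M') z = 0"
    using eigenvalue_root_char_poly[OF M'] by (auto simp: eigenvalue_def)
  moreover have "char_poly M' = map_poly of_int (char_poly M)"
    unfolding M'_def by (rule of_int_hom.char_poly_hom[OF M])
  moreover have "lead_coeff (char_poly M) = 1" using degree_monic_char_poly[OF M] by simp
  ultimately show ?thesis unfolding algebraic_int_altdef_ipoly by auto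
qed

text \<open>This is the ring Z[\<zeta>].\<close>

definition int_adjoin :: "complex \<Rightarrow> complex set" where
  "int_adjoin \<zeta> = range (\<lambda>q :: int poly. poly (map_poly of_int q) \<zeta>)"

lemma int_adjoin_add: "x \<in> int_adjoin \<zeta> \<Longrightarrow> y \<in> int_adjoin \<zeta> \<Longrightarrow> x + y \<in> int_adjoin \<zeta>"
  unfolding int_adjoin_def by (auto simp flip: poly_add of_int_poly_hom.hom_add)

lemma int_adjoin_mult: "x \<in> int_adjoin \<zeta> \<Longrightarrow> y \<in> int_adjoin \<zeta> \<Longrightarrow> x * y \<in> int_adjoin \<zeta>"
  unfolding int_adjoin_def by (auto simp flip: poly_mult of_int_poly_hom.hom_mult)

lemma int_adjoin_of_int [simp]: "of_int m \<in> int_adjoin \<zeta>"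
  unfolding int_adjoin_def by (rule range_eqI[of _ _ "[:m:]"]) (simp add: of_int_hom.map_poly_pCons_hom)

lemma int_adjoin_0 [simp]: "0 \<in> int_adjoin \<zeta>" and int_adjoin_1 [simp]: "1 \<in> int_adjoin \<zeta>"
  and int_adjoin_of_nat [simp]: "of_nat k \<in> int_adjoin \<zeta>"
  using int_adjoin_of_int[of 0] int_adjoin_of_int[of 1] int_adjoin_of_int[of "int k"] by simp_all

lemma int_adjoin_generator: "\<zeta> \<in> int_adjoin \<zeta>"
  unfolding int_adjoin_def by (rule range_eqI[of _ _ "[:0, 1:]"]) (simp add: of_int_hom.map_poly_pCons_hom)

lemma int_adjoin_power: "x \<in> int_adjoin \<zeta> \<Longrightarrow> x ^ k \<in> int_adjoin \<zeta>"
  by (induction k) (auto intro: int_adjoin_mult)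

lemma int_adjoin_diff:
  assumes "x \<in> int_adjoin \<zeta>" "y \<in> int_adjoin \<zeta>"
  shows "x - y \<in> int_adjoin \<zeta>"
  using int_adjoin_add[OF assms(1) int_adjoin_mult[OF int_adjoin_of_int[of "-1"] assms(2)]] by simp

lemma int_adjoin_sum:
  "(\<And>i. i \<in> I \<Longrightarrow> f i \<in> int_adjoin \<zeta>) \<Longrightarrow> sum f I \<in> int_adjoin \<zeta>"
  by (induction I rule: infinite_finite_induct) (auto intro: int_adjoin_add)

text \<open>
  The additive group spanned by the powers of \<open>\<zeta>\<close> is finitely generated and stable under
  multiplication by \<open>z\<close>, so \<open>z\<close> is an eigenvalue of an integer matrix.
\<close>

lemma int_adjoin_root_of_unity_algebraic_int:
  assumes z: "z \<in> int_adjoin \<zeta>" and n: "n > 0" and \<zeta>: "\<zeta> ^ n = 1"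
  shows "algebraic_int z"
proof -
  define M where "M = {x. \<exists>c :: nat \<Rightarrow> int. x = (\<Sum>j<n. of_int (c j) * \<zeta> ^ j)}"
  have M_add: "of_int m * \<zeta> ^ i + x \<in> M" if i: "i < n" and x: "x \<in> M" for m i x
  proof -
    from x obtain c :: "nat \<Rightarrow> int" where c: "x = (\<Sum>j<n. of_int (c j) * \<zeta> ^ j)"
      by (auto simp: M_def)
    have "of_int m * \<zeta> ^ i + x = (\<Sum>j<n. (if j = i then of_int m * \<zeta> ^ i else 0) + of_int (c j) * \<zeta> ^ j)"
      using i by (simp add: sum.distrib c)
    also have "\<dots> = (\<Sum>j<n. of_int (c j + (if j = i then m else 0)) * \<zeta> ^ j)"
      by (intro sum.cong) (auto simp: algebra_simps)
    finally show ?thesis unfolding M_def by (intro CollectI exI)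
  qed
  have M_shift: "\<zeta> * x \<in> M" if x: "x \<in> M" for x
  proof -
    from x obtain c :: "nat \<Rightarrow> int" where c: "x = (\<Sum>j<n. of_int (c j) * \<zeta> ^ j)"
      by (auto simp: M_def)
    \<comment> \<open>The shifted sum is built up one monomial at a time. Only the exponent
      \<open>n\<close> leaves the range, and it wraps around to 0 because
      \<open>\<zeta> ^ n = 1\<close>.\<close>
    have "(\<Sum>j\<in>J. of_int (c j) * \<zeta> ^ Suc j) \<in> M" if "finite J" "J \<subseteq> {..<n}" for J
      using that
    proof (induction J rule: finite_induct)
      case empty
      show ?case by (auto simp: M_def intro!: exI[of _ "\<lambda>_. 0"])
    next
      case (insert j J)
      have "of_int (c j) * \<zeta> ^ (Suc j mod n) + (\<Sum>j\<in>J. of_int (c j) * \<zeta> ^ Suc j) \<in> M"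
        by (intro M_add) (use insert n in auto)
      moreover have "\<zeta> ^ (Suc j mod n) = \<zeta> ^ Suc j"
      proof (cases "Suc j = n")
        case True then show ?thesis using \<zeta> by simp
      next
        case False then show ?thesis using insert by simp
      qed
      ultimately show ?case using insert by (simp del: power_Suc)
    qed
    from this[of "{..<n}"] show ?thesis
      by (simp add: c sum_distrib_left mult.left_commute)
  qed
  have M_plus: "of_int m * x + w \<in> M" if "x \<in> M" "w \<in> M" for m x w
  proof -
    from that obtain c d :: "nat \<Rightarrow> int" where c: "x = (\<Sum>j<n. of_int (c j) * \<zeta> ^ j)"
      and d: "w = (\<Sum>j<n. of_int (d j) * \<zeta> ^ j)"
      by (auto simp: M_def)
    have "of_int m * x + w = (\<Sum>j<n. of_int (m * c j + d j) * \<zeta> ^ j)"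
      by (simp add: c d sum_distrib_left sum.distrib algebra_simps)
    then show ?thesis unfolding M_def by (intro CollectI exI)
  qed
  obtain q :: "int poly" where q: "z = poly (map_poly of_int q) \<zeta>"
    using z by (auto simp: int_adjoin_def)
  have M_poly: "poly (map_poly of_int q) \<zeta> * x \<in> M" if x: "x \<in> M" for q :: "int poly" and x
  proof (induction q)
    case 0
    show ?case by (auto simp: M_def intro!: exI[of _ "\<lambda>_. 0"])
  next
    case (pCons a q)
    have "of_int a * x + \<zeta> * (poly (map_poly of_int q) \<zeta> * x) \<in> M"
      by (intro M_plus M_shift x pCons)
    then show ?case by (simp add: of_int_hom.map_poly_pCons_hom algebra_simps)
  qed
  have "\<zeta> ^ i \<in> M" if "i < n" for i
  proof -
    have "0 \<in> M" by (auto simp: M_def intro!: exI[of _ "\<lambda>_. 0"])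
    from M_add[OF that this, of 1] show ?thesis by simp
  qed
  then have "\<exists>c :: nat \<Rightarrow> int. z * \<zeta> ^ i = (\<Sum>j<n. of_int (c j) * \<zeta> ^ j)" if "i < n" for i
    using M_poly[of "\<zeta> ^ i" q] that by (auto simp: M_def q)
  then obtain c :: "nat \<Rightarrow> nat \<Rightarrow> int"
    where "\<And>i. i < n \<Longrightarrow> z * \<zeta> ^ i = (\<Sum>j<n. of_int (c i j) * \<zeta> ^ j)"
    by metis
  \<comment> \<open>Entry 0 of the eigenvector is \<open>\<zeta> ^ 0 = 1\<close>, hence
    nonzero.\<close>
  then show ?thesis
    by (rule algebraic_int_if_int_eigenvalue[where ?i0.0 = 0]) (use n in auto)
qed

section \<open>Congruences modulo a prime\<close>

text \<open>The quotient of \<open>m\<close> by \<open>p\<close> is both rational and an algebraic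
  integer, hence an integer. Thus divisibility by \<open>p\<close> in Z[\<zeta>] descends to the
  integers.\<close>

lemma int_adjoin_dvd:
  assumes "z \<in> int_adjoin \<zeta>" "n > 0" "\<zeta> ^ n = 1" and p: "p > 0" "of_nat p * z = of_int m"
  shows "int p dvd m"
proof -
  have z: "z = of_int m / of_int (int p)" using p by (simp add: field_simps)
  then have "z \<in> \<rat>" by (simp add: Rats_divide)
  then have "z \<in> \<int>"
    using int_adjoin_root_of_unity_algebraic_int[OF assms(1-3)] rational_algebraic_int_is_int by blast
  then obtain k where "z = of_int k" by (elim Ints_cases)
  then have "complex_of_int m = of_int (int p * k)" using p by simp
  then have "m = int p * k" unfolding of_int_eq_iff .
  then show ?thesis by simp
qed

text \<open>Modulo \<open>p\<close>, the \<open>p\<close>-th power is additive on Z[\<zeta>],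
  because \<open>p\<close> divides the middle binomial coefficients; \<open>r'\<close> collects the
  middle terms divided by \<open>p\<close>.\<close>

lemma sum_power_prime_int_adjoin:
  assumes p: "prime p" and S: "finite S" and f: "\<And>s. s \<in> S \<Longrightarrow> f s \<in> int_adjoin \<zeta>"
  shows "\<exists>r\<in>int_adjoin \<zeta>. (\<Sum>s\<in>S. f s) ^ p = (\<Sum>s\<in>S. f s ^ p) + of_nat p * r"
  using S f
proof (induction S rule: finite_induct)
  case empty
  show ?case using prime_gt_0_nat[OF p] by (intro bexI[of _ 0]) auto
next
  case (insert s S)
  define x where "x = f s"
  define w where "w = sum f S"
  obtain r where r: "r \<in> int_adjoin \<zeta>" "w ^ p = (\<Sum>s\<in>S. f s ^ p) + of_nat p * r"
    using insert by (auto simp: w_def)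
  have xw: "x \<in> int_adjoin \<zeta>" "w \<in> int_adjoin \<zeta>"
    using insert by (auto simp: x_def w_def intro: int_adjoin_sum)
  define r' where "r' = (\<Sum>k\<in>{1..<p}. of_nat ((p choose k) div p) * (x ^ k * w ^ (p - k)))"
  have r': "r' \<in> int_adjoin \<zeta>"
    unfolding r'_def by (intro int_adjoin_sum int_adjoin_mult int_adjoin_power xw int_adjoin_of_nat)
  have p0: "p > 0" using prime_gt_0_nat[OF p] .
  have split: "{..p} = insert 0 (insert p {1..<p})" using p0 by auto
  have "(x + w) ^ p = (\<Sum>k\<le>p. of_nat (p choose k) * x ^ k * w ^ (p - k))"
    by (rule binomial_ring)
  also have "\<dots> = w ^ p + x ^ p + (\<Sum>k\<in>{1..<p}. of_nat (p choose k) * x ^ k * w ^ (p - k))"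
    unfolding split using p0 by simp
  also have "(\<Sum>k\<in>{1..<p}. of_nat (p choose k) * x ^ k * w ^ (p - k)) = of_nat p * r'"
    unfolding r'_def sum_distrib_left
  proof (intro sum.cong refl)
    fix k assume "k \<in> {1..<p}"
    then have "p dvd (p choose k)" using p by (intro dvd_choose_prime) auto
    then have "of_nat (p choose k) = (of_nat p * of_nat ((p choose k) div p) :: complex)"
      by (metis dvd_mult_div_cancel of_nat_mult)
    then show "of_nat (p choose k) * x ^ k * w ^ (p - k) =
        of_nat p * (of_nat ((p choose k) div p) * (x ^ k * w ^ (p - k)))" by simp
  qed
  finally have "(x + w) ^ p = (x ^ p + (\<Sum>s\<in>S. f s ^ p)) + of_nat p * (r + r')"
    by (simp add: r algebra_simps)
  then show ?case using insert r' r(1)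
    by (intro bexI[of _ "r + r'"]) (auto simp: x_def w_def int_adjoin_add)
qed

text \<open>Fermat's little theorem for all integers: \<open>m\<close> is replaced by its residue
  \<open>a\<close>, and the case \<open>p dvd a\<close> is treated separately.\<close>

lemma int_power_prime_dvd_diff:
  fixes m :: int
  assumes p: "prime p"
  shows "int p dvd m ^ p - m"
proof -
  define a where "a = nat (m mod int p)"
  have p0: "p > 0" using prime_gt_0_nat[OF p] .
  have a: "[m = int a] (mod int p)" using p0 by (simp add: a_def cong_def)
  have "[a ^ p = a] (mod p)"
  proof (cases "p dvd a")
    case True
    then have "p dvd a ^ p" using p0 by (metis dvd_power dvd_trans)
    then show ?thesis using True by (simp add: cong_def)
  next
    case False
    from cong_scalar_left[OF fermat_theorem[OF p this], of a] show ?thesis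
      using p0 by (simp add: power_eq_if)
  qed
  then have "[int a ^ p = int a] (mod int p)" by (metis cong_int_iff of_nat_power)
  then have "[m ^ p = m] (mod int p)" using a by (meson cong_pow cong_sym cong_trans)
  then show ?thesis by (simp add: cong_iff_dvd_diff)
qed

section \<open>Sets with integral character sums\<close>

context finite_comm_group
begin

text \<open>The values of all characters are powers of this root of unity, so one ring
  \<open>int_adjoin zeta\<close> contains them all.\<close>

definition zeta :: complex where "zeta = cis (2 * pi / real (order A))"

lemma zeta_power_order: "zeta ^ order A = 1"
  using order_pos by (simp add: zeta_def DeMoivre)

lemma char_in_int_adjoin:
  assumes "\<chi> \<in> hom A complex_units" "a \<in> carrier A"
  shows "\<chi> a \<in> int_adjoin zeta"
proof -
  have "\<chi> a \<in> (\<lambda>k. cis (2 * pi * real k / real (order A))) ` {..<order A}"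
    using char_root_of_unity[OF assms] bij_betw_imp_surj_on[OF bij_betw_roots_unity[OF order_pos]]
    by auto
  then obtain k where "\<chi> a = zeta ^ k"
    by (auto simp: zeta_def DeMoivre mult.commute)
  then show ?thesis by (simp add: int_adjoin_power int_adjoin_generator)
qed

lemma char_sum_algebraic_int:
  assumes "\<chi> \<in> hom A complex_units" "S \<subseteq> carrier A"
  shows "algebraic_int (\<Sum>s\<in>S. \<chi> s)"
  using assms
  by (intro int_adjoin_root_of_unity_algebraic_int[OF _ order_pos zeta_power_order] int_adjoin_sum
      char_in_int_adjoin) auto

section \<open>Closure under powers with exponent coprime to the group order\<close>

text \<open>If \<open>a\<close> and \<open>b\<close> have the same \<open>k\<close>-th power, the
  order of \<open>a \<otimes> inv b\<close> divides both \<open>k\<close> and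
  \<open>order A\<close>, so it is 1.\<close>

lemma inj_on_coprime_pow:
  assumes "coprime k (order A)"
  shows "inj_on (\<lambda>a. a [^] k) (carrier A)"
proof (rule inj_onI)
  fix a b assume ab: "a \<in> carrier A" "b \<in> carrier A" "a [^] k = b [^] k"
  have "(a \<otimes> inv b) [^] k = \<one>"
    using ab by (simp add: pow_mult_distrib[OF m_comm] nat_pow_inv)
  then have "ord (a \<otimes> inv b) dvd k" using ab by (simp add: pow_eq_id)
  moreover have "ord (a \<otimes> inv b) dvd order A" using ab by (intro ord_dvd_group_order) auto
  ultimately have "ord (a \<otimes> inv b) = 1" using assms by (metis coprime_common_divisor_nat)
  then have "a \<otimes> inv b = \<one>" using ab by (metis inv_closed m_closed ord_eq_1)
  then show "a = b" using ab by (metis inv_closed inv_equality inv_inv)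
qed

text \<open>
  Modulo \<open>p\<close>, the character sum over the \<open>p\<close>-th powers of \<open>S\<close> is the \<open>p\<close>-th power of the character sum
  over \<open>S\<close>, hence, for integral sums, equal to it by Fermat. As \<open>p\<close> does not divide the order of the
  group, Fourier inversion shows that the two indicator functions agree modulo \<open>p\<close>.
\<close>

lemma integral_char_sums_closed_prime_pow:
  assumes S: "S \<subseteq> carrier A"
    and int: "\<And>\<chi>. \<chi> \<in> hom A complex_units \<Longrightarrow> (\<Sum>s\<in>S. \<chi> s) \<in> \<int>"
    and p: "prime p" "\<not> p dvd order A" and s: "s \<in> S"
  shows "s [^] p \<in> S"
proof -
  have cop: "coprime p (order A)" using p by (simp add: prime_imp_coprime)
  have finS: "finite S" using S finite_carrier by (rule finite_subset)
  define T where "T = (\<lambda>s. s [^] p) ` S"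
  define u :: "'a \<Rightarrow> int" where "u x = of_bool (x \<in> T) - of_bool (x \<in> S)" for x
  define f where "f x = complex_of_int (u x)" for x
  have T: "T \<subseteq> carrier A" using S by (auto simp: T_def)
  have injS: "inj_on (\<lambda>s. s [^] p) S" using inj_on_coprime_pow[OF cop] S inj_on_subset by blast
  have "\<exists>r\<in>int_adjoin zeta. fourier f \<chi> = of_nat p * r" if \<chi>: "\<chi> \<in> hom A complex_units" for \<chi>
  proof -
    \<comment> \<open>The Fourier transform evaluates \<open>\<chi>\<close> at inverses. This
      conjugates the character sum, which has no effect on an integer.\<close>
    have "(\<Sum>s\<in>S. \<chi> (inv s)) = cnj (\<Sum>s\<in>S. \<chi> s)"
      using S \<chi> by (auto simp: char_inv_cnj intro!: sum.cong)
    moreover obtain m where "(\<Sum>s\<in>S. \<chi> s) = of_int m"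
      using int[OF \<chi>] by (rule Ints_cases)
    ultimately have m: "(\<Sum>s\<in>S. \<chi> (inv s)) = of_int m" by (simp only: complex_cnj_of_int)
    obtain r where r: "r \<in> int_adjoin zeta"
      "(\<Sum>s\<in>S. \<chi> (inv s)) ^ p = (\<Sum>s\<in>S. \<chi> (inv s) ^ p) + of_nat p * r"
      using sum_power_prime_int_adjoin[OF p(1) finS, of "\<lambda>s. \<chi> (inv s)" zeta]
        char_in_int_adjoin[OF \<chi>] S by blast
    obtain q where q: "m ^ p - m = int p * q" using int_power_prime_dvd_diff[OF p(1)] by blast
    have "fourier f \<chi> = (\<Sum>x\<in>carrier A. of_bool (x \<in> T) * \<chi> (inv x)) -
        (\<Sum>x\<in>carrier A. of_bool (x \<in> S) * \<chi> (inv x))"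
      by (simp add: fourier_def f_def u_def algebra_simps sum_subtractf)
    also have "(\<Sum>x\<in>carrier A. of_bool (x \<in> T) * \<chi> (inv x)) = (\<Sum>x\<in>T. \<chi> (inv x))"
      using T by (intro sum.mono_neutral_cong_right) auto
    also have "(\<Sum>x\<in>carrier A. of_bool (x \<in> S) * \<chi> (inv x)) = (\<Sum>x\<in>S. \<chi> (inv x))"
      using S by (intro sum.mono_neutral_cong_right) auto
    also have "(\<Sum>x\<in>T. \<chi> (inv x)) = (\<Sum>s\<in>S. \<chi> (inv s) ^ p)"
      unfolding T_def sum.reindex[OF injS]
      by (intro sum.cong) (use S \<chi> in \<open>auto simp: char_inv char_pow power_inverse\<close>)
    \<comment> \<open>The Frobenius congruence turns the first sum into \<open>m ^ p\<close> up to a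
      multiple of \<open>p\<close>; Fermat then makes \<open>m ^ p - m\<close> such a multiple
      too.\<close>
    also have "\<dots> - (\<Sum>x\<in>S. \<chi> (inv x)) = of_int (m ^ p - m) - of_nat p * r"
      using r(2) m by simp
    also have "\<dots> = of_nat p * (of_int q - r)" by (simp add: q algebra_simps)
    finally show ?thesis using r(1) by (blast intro: int_adjoin_diff int_adjoin_of_int)
  qed
  then obtain r where r: "\<And>\<chi>. \<chi> \<in> hom A complex_units \<Longrightarrow>
      r \<chi> \<in> int_adjoin zeta \<and> fourier f \<chi> = of_nat p * r \<chi>"
    by metis
  define a where "a = s [^] p"
  have a: "a \<in> carrier A" "a \<in> T" using s S by (auto simp: a_def T_def)
  define z where "z = (\<Sum>\<chi>\<in>characters. r \<chi> * \<chi> a)"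
  have "of_nat (order A) * f a = (\<Sum>\<chi>\<in>characters. fourier f \<chi> * \<chi> a)"
    by (rule fourier_inversion[OF a(1), symmetric])
  also have "\<dots> = of_nat p * z"
    unfolding z_def sum_distrib_left
    by (intro sum.cong) (auto simp: r[OF characters_hom])
  finally have "of_nat p * z = of_int (int (order A) * u a)" by (simp add: f_def)
  moreover have "z \<in> int_adjoin zeta"
    unfolding z_def using r characters_hom char_in_int_adjoin a
    by (intro int_adjoin_sum int_adjoin_mult) blast+
  ultimately have "int p dvd int (order A) * u a"
    using int_adjoin_dvd[OF _ order_pos zeta_power_order prime_gt_0_nat[OF p(1)]] by blast
  moreover have "\<not> int p dvd int (order A)" using p(2) by simp
  ultimately have "int p dvd u a" using p(1) by (metis prime_dvd_mult_iff prime_nat_int_transfer)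
  \<comment> \<open>As \<open>a \<in> T\<close>, the value \<open>u a\<close> is 0 if
    \<open>a \<in> S\<close> and 1 otherwise; divisibility by \<open>p\<close> excludes 1.\<close>
  moreover have "\<not> int p dvd 1" using prime_gt_1_nat[OF p(1)] by simp
  ultimately show ?thesis using a by (cases "a \<in> S") (auto simp: u_def a_def)
qed

text \<open>Prime factors of \<open>k\<close> are split off one at a time; none of them divides
  \<open>order A\<close>.\<close>

lemma integral_char_sums_closed_coprime_pow:
  assumes S: "S \<subseteq> carrier A"
    and int: "\<And>\<chi>. \<chi> \<in> hom A complex_units \<Longrightarrow> (\<Sum>s\<in>S. \<chi> s) \<in> \<int>"
    and k: "k > 0" "coprime k (order A)" and s: "s \<in> S"
  shows "s [^] k \<in> S"
  using k s
proof (induction k arbitrary: s rule: less_induct)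
  case (less k)
  show ?case
  proof (cases "k = 1")
    case True
    then show ?thesis using less S by auto
  next
    case False
    then obtain p where p: "prime p" "p dvd k" using prime_factor_nat by blast
    then obtain l where l: "k = p * l" by auto
    have "l > 0" "l < k" using less(2) prime_gt_1_nat[OF p(1)] by (auto simp: l)
    moreover have "coprime l (order A)" "coprime p (order A)" using less(3) by (auto simp: l)
    moreover have "\<not> p dvd order A"
      using \<open>coprime p (order A)\<close> p(1) by (metis coprime_absorb_left not_prime_unit)
    ultimately have "(s [^] p) [^] l \<in> S"
      using integral_char_sums_closed_prime_pow[OF S int p(1) _ less(4)] less(1) by blast
    then show ?thesis using S less(4) by (simp add: l nat_pow_pow subset_iff)
  qed
qed

text \<open>A unit modulo \<open>ord a\<close> lifts to a unit modulo \<open>order A\<close>, and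
  \<open>a [^] k\<close> depends only on \<open>k\<close> modulo \<open>ord a\<close>. This makes
  the closure under powers coprime to the group order applicable to every generator of a cyclic
  subgroup.\<close>

lemma exists_coprime_order_pow_eq:
  assumes a: "a \<in> carrier A" and k: "coprime k (ord a)"
  shows "\<exists>k'>0. coprime k' (order A) \<and> a [^] k' = a [^] k"
proof -
  \<comment> \<open>Each prime factor of \<open>order A\<close> divides exactly one of the two summands of \<open>k'\<close> below.\<close>
  define t where "t = \<Prod>{q. q \<in> prime_factors (order A) \<and> \<not> q dvd k}"
  define k' where "k' = k + ord a * t"
  have t0: "t > 0" unfolding t_def by (intro prod_pos) (auto intro: prime_gt_0_nat)
  have "ord a > 0" using ord_ge_1[OF finite_carrier a] by simp
  then have "k' > 0" using t0 by (simp add: k'_def)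
  moreover have "coprime k' (order A)"
  proof (rule ccontr)
    assume "\<not> ?thesis"
    then have "gcd k' (order A) \<noteq> 1" by (simp add: coprime_iff_gcd_eq_1)
    then obtain q where "prime q" "q dvd gcd k' (order A)" using prime_factor_nat by blast
    then have q: "prime q" "q dvd k'" "q dvd order A" by auto
    show False
    proof (cases "q dvd k")
      case True
      then have "\<not> q dvd ord a" using k q(1) by (metis coprime_common_divisor not_prime_unit)
      moreover have "\<not> q dvd t"
      proof
        assume "q dvd t"
        then obtain q' where "q' \<in> prime_factors (order A)" "\<not> q' dvd k" "q dvd q'"
          unfolding t_def using q(1) by (auto simp: prime_dvd_prod_iff)
        then show False using True q(1) by (metis in_prime_factors_imp_prime primes_dvd_imp_eq)
      qed
      ultimately have "\<not> q dvd ord a * t" using q(1) by (simp add: prime_dvd_mult_iff)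
      then show False using q(2) True by (simp add: k'_def dvd_add_right_iff)
    next
      case False
      then have "q dvd t" unfolding t_def
        using q order_pos by (intro dvd_prodI) (auto simp: in_prime_factors_iff)
      then show False using False q(2) by (simp add: k'_def dvd_add_left_iff)
    qed
  qed
  moreover have "a [^] k' = a [^] k"
    using a by (simp add: k'_def nat_pow_mult[symmetric] nat_pow_pow[symmetric])
  ultimately show ?thesis by blast
qed

text \<open>The assumption makes \<open>l\<close> an inverse of \<open>k\<close> modulo
  \<open>ord a\<close>. Exponents are compared as integers because \<open>k * l\<close> may be
  0.\<close>

lemma pow_pow_eq_imp_coprime:
  fixes k l :: nat
  assumes a: "a \<in> carrier A" and "(a [^] k) [^] l = a"
  shows "coprime k (ord a)"
proof -
  have "a [^] (k * l) = a [^] (1::nat)" using assms by (simp add: nat_pow_pow)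
  then have "a [^] (int (k * l) - 1) = \<one>"
    using a by (simp add: int_pow_diff int_pow_int del: of_nat_mult)
  then have "int (ord a) dvd int (k * l) - 1" using a by (simp add: int_pow_eq_id)
  then have "[int k * int l = 1] (mod int (ord a))" by (simp add: cong_iff_dvd_diff)
  then have "coprime (int k) (int (ord a))" unfolding coprime_iff_invertible_int by blast
  then show ?thesis by simp
qed

end

section \<open>The Boolean algebra of subgroups\<close>

context finite_comm_group
begin

section \<open>Atoms of the Boolean algebra\<close>

lemma pow_in_subgroup:
  "subgroup H A \<Longrightarrow> a \<in> H \<Longrightarrow> a [^] (k::nat) \<in> H"
  by (induction k) (auto intro: subgroup.one_closed subgroup.m_closed)

lemma subgroup_cyclic:
  assumes a: "a \<in> carrier A"
  shows "subgroup (range (\<lambda>k::nat. a [^] k)) A"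
proof -
  have "range (\<lambda>k::nat. a [^] k) = generate A {a}"
    using generate_pow_nat[OF a] ord_ge_1[OF finite_carrier a] by auto
  then show ?thesis using generate_is_subgroup[of "{a}"] a by simp
qed

lemma empty_in_subgroup_algebra: "{} \<in> subgroup_algebra A"
  using subgroup_algebra.compl[OF subgroup_algebra.subgroup[OF subgroup_self]] by simp

lemma subgroup_algebra_UN:
  "finite I \<Longrightarrow> (\<And>i. i \<in> I \<Longrightarrow> f i \<in> subgroup_algebra A) \<Longrightarrow> (\<Union>i\<in>I. f i) \<in> subgroup_algebra A"
  by (induction I rule: finite_induct) (auto intro: empty_in_subgroup_algebra subgroup_algebra.union)

text \<open>Being powers of each other means generating the same cyclic subgroup; natural exponents
  suffice since all orders are finite.\<close>

definition generators_of_cyclic :: "'a \<Rightarrow> 'a set" where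
  "generators_of_cyclic a = {b. (\<exists>k::nat. b = a [^] k) \<and> (\<exists>l::nat. a = b [^] l)}"

text \<open>The generators are what remains of the cyclic subgroup of \<open>a\<close> after
  removing the cyclic subgroups of those of its elements \<open>b\<close> that do not generate
  \<open>a\<close>.\<close>

lemma generators_of_cyclic_in_subgroup_algebra:
  assumes a: "a \<in> carrier A"
  shows "generators_of_cyclic a \<in> subgroup_algebra A"
proof -
  let ?C = "\<lambda>b. range (\<lambda>k::nat. b [^] k)"
  define B where "B = {b \<in> ?C a. a \<notin> ?C b}"
  have Ca: "?C a \<subseteq> carrier A" using a by auto
  then have B: "B \<subseteq> carrier A" "finite B"
    using finite_subset[OF _ finite_carrier, of B] by (auto simp: B_def)
  have "(\<Union>b\<in>B. ?C b) \<in> subgroup_algebra A"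
    using B by (intro subgroup_algebra_UN subgroup_algebra.subgroup subgroup_cyclic) auto
  then have "?C a \<inter> (carrier A - (\<Union>b\<in>B. ?C b)) \<in> subgroup_algebra A"
    using subgroup_algebra.inter[OF subgroup_algebra.subgroup[OF subgroup_cyclic[OF a]]
        subgroup_algebra.compl] by blast
  also have "?C a \<inter> (carrier A - (\<Union>b\<in>B. ?C b)) = generators_of_cyclic a" (is "?L = ?R")
  proof (intro equalityI subsetI)
    fix c assume c: "c \<in> ?L"
    then have "c \<in> carrier A" by simp
    then have "c \<in> ?C c" by (metis nat_pow_eone rangeI)
    then have "c \<notin> B" using c by blast
    then show "c \<in> ?R" using c by (auto simp: B_def generators_of_cyclic_def)
  next
    fix c assume "c \<in> ?R"
    then obtain k l :: nat where c: "c = a [^] k" "a = c [^] l"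
      by (auto simp: generators_of_cyclic_def)
    have "c \<notin> ?C b" if b: "b \<in> B" for b
    proof
      assume "c \<in> ?C b"
      then have "a \<in> ?C b"
        using c(2) pow_in_subgroup[OF subgroup_cyclic] b B(1) by blast
      then show False using b by (simp add: B_def)
    qed
    then show "c \<in> ?L" using c(1) a by auto
  qed
  finally show ?thesis .
qed

text \<open>A generator \<open>b\<close> of the cyclic subgroup of \<open>a \<in> S\<close> is a
  power of \<open>a\<close> with exponent coprime to \<open>order A\<close>, hence in
  \<open>S\<close>. So \<open>S\<close> is a finite union of generator sets.\<close>

theorem integral_char_sums_imp_subgroup_algebra:
  assumes S: "S \<subseteq> carrier A"
    and int: "\<And>\<chi>. \<chi> \<in> hom A complex_units \<Longrightarrow> (\<Sum>s\<in>S. \<chi> s) \<in> \<int>"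
  shows "S \<in> subgroup_algebra A"
proof -
  have "b \<in> S" if a: "a \<in> S" and b: "b \<in> generators_of_cyclic a" for a b
  proof -
    obtain k l :: nat where kl: "b = a [^] k" "a = b [^] l"
      using b by (auto simp: generators_of_cyclic_def)
    have ac: "a \<in> carrier A" using a S by auto
    obtain k' where "k' > 0" "coprime k' (order A)" "a [^] k' = a [^] k"
      using exists_coprime_order_pow_eq[OF ac pow_pow_eq_imp_coprime[OF ac]] kl by metis
    then show ?thesis using integral_char_sums_closed_coprime_pow[OF S int _ _ a] kl by metis
  qed
  moreover have "a \<in> generators_of_cyclic a" if "a \<in> S" for a
    using that S by (auto simp: generators_of_cyclic_def intro!: exI[of _ "1::nat"])
  ultimately have "S = (\<Union>a\<in>S. generators_of_cyclic a)" by blast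
  moreover have "(\<Union>a\<in>S. generators_of_cyclic a) \<in> subgroup_algebra A"
    using S finite_subset[OF S finite_carrier]
    by (intro subgroup_algebra_UN generators_of_cyclic_in_subgroup_algebra) auto
  ultimately show ?thesis by simp
qed

section \<open>Character sums over sets in the Boolean algebra\<close>

text \<open>Boolean operations are replaced by linear ones, since character sums are additive in the
  weight function.\<close>

inductive_set subgroup_span :: "('a \<Rightarrow> int) set" where
  indicator: "subgroup H A \<Longrightarrow> (\<lambda>x. of_bool (x \<in> H)) \<in> subgroup_span"
| add: "f \<in> subgroup_span \<Longrightarrow> g \<in> subgroup_span \<Longrightarrow> (\<lambda>x. f x + g x) \<in> subgroup_span"
| diff: "f \<in> subgroup_span \<Longrightarrow> g \<in> subgroup_span \<Longrightarrow> (\<lambda>x. f x - g x) \<in> subgroup_span"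

text \<open>By bilinearity only two indicators need be multiplied, and their product is the
  indicator of the intersection of the two subgroups.\<close>

lemma subgroup_span_mult:
  assumes f: "f \<in> subgroup_span" and g: "g \<in> subgroup_span"
  shows "(\<lambda>x. f x * g x) \<in> subgroup_span"
  using f
proof induction
  case (indicator H)
  show ?case using g
  proof induction
    case (indicator K)
    have "(\<lambda>x. of_bool (x \<in> H \<inter> K)) \<in> subgroup_span"
      using \<open>subgroup H A\<close> indicator by (intro subgroup_span.indicator subgroups_Inter_pair)
    then show ?case by (simp add: of_bool_conj)
  qed (auto simp: algebra_simps intro: subgroup_span.intros)
qed (auto simp: algebra_simps intro: subgroup_span.intros)

text \<open>Unions are handled by inclusion-exclusion. The inclusion in \<open>carrier A\<close> is
  carried along because the complement case subtracts the indicator of \<open>X\<close> from that of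
  \<open>carrier A\<close>.\<close>

lemma subgroup_algebra_indicator:
  "S \<in> subgroup_algebra A \<Longrightarrow> S \<subseteq> carrier A \<and> (\<lambda>x. of_bool (x \<in> S)) \<in> subgroup_span"
proof (induction rule: subgroup_algebra.induct)
  case (subgroup H)
  then show ?case by (auto intro: subgroup_span.indicator dest: subgroup.subset)
next
  case (inter X Y)
  then show ?case using subgroup_span_mult by (auto simp: of_bool_conj)
next
  case (union X Y)
  then have "(\<lambda>x. of_bool (x \<in> X) + of_bool (x \<in> Y) - of_bool (x \<in> X) * of_bool (x \<in> Y)) \<in> subgroup_span"
    by (intro subgroup_span.add subgroup_span.diff subgroup_span_mult) auto
  also have "(\<lambda>x. of_bool (x \<in> X) + of_bool (x \<in> Y) - of_bool (x \<in> X) * of_bool (x \<in> Y)) =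
      (\<lambda>x. of_bool (x \<in> X \<union> Y) :: int)" by auto
  finally show ?case using union by auto
next
  case (compl X)
  then have "(\<lambda>x. of_bool (x \<in> carrier A) - of_bool (x \<in> X)) \<in> subgroup_span"
    using subgroup_span.diff[OF subgroup_span.indicator[OF subgroup_self]] by blast
  also have "(\<lambda>x. of_bool (x \<in> carrier A) - of_bool (x \<in> X)) = (\<lambda>x. of_bool (x \<in> carrier A - X) :: int)"
    using compl by (auto simp: fun_eq_iff)
  finally show ?case by auto
qed

lemma char_sum_subgroup:
  assumes H: "subgroup H A" and \<chi>: "\<chi> \<in> hom A complex_units"
  shows "(\<Sum>h\<in>H. \<chi> h) \<in> \<int>"
proof (cases "\<forall>h\<in>H. \<chi> h = 1")
  case True
  then show ?thesis by simp
next
  case False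
  then obtain b where b: "b \<in> H" "\<chi> b \<noteq> 1" by auto
  have HA: "H \<subseteq> carrier A" using H by (rule subgroup.subset)
  have "\<chi> b * (\<Sum>h\<in>H. \<chi> h) = (\<Sum>h\<in>H. \<chi> (b \<otimes> h))"
    unfolding sum_distrib_left by (intro sum.cong) (use b \<chi> HA in \<open>auto simp: char_mult subset_iff\<close>)
  also have "\<dots> = (\<Sum>h\<in>H. \<chi> h)"
    by (rule sum.reindex_bij_witness[of _ "\<lambda>x. inv b \<otimes> x" "\<lambda>x. b \<otimes> x"])
      (use b H HA in \<open>auto simp: m_assoc[symmetric] subset_iff
        intro: subgroup.m_closed subgroup.m_inv_closed\<close>)
  finally show ?thesis using b(2) by simp
qed

theorem subgroup_algebra_imp_integral_char_sum:
  assumes S: "S \<in> subgroup_algebra A" and \<chi>: "\<chi> \<in> hom A complex_units"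
  shows "(\<Sum>s\<in>S. \<chi> s) \<in> \<int>"
proof -
  have weighted: "(\<Sum>s\<in>carrier A. of_int (f s) * \<chi> s) \<in> \<int>" if "f \<in> subgroup_span" for f
    using that
  proof induction
    case (indicator H)
    then have "(\<Sum>s\<in>carrier A. of_int (of_bool (s \<in> H)) * \<chi> s) = (\<Sum>s\<in>H. \<chi> s)"
      by (intro sum.mono_neutral_cong_right) (auto dest: subgroup.subset)
    then show ?case using char_sum_subgroup[OF indicator \<chi>] by simp
  qed (auto simp: algebra_simps sum.distrib sum_subtractf)
  have "S \<subseteq> carrier A" and span: "(\<lambda>x. of_bool (x \<in> S)) \<in> subgroup_span"
    using subgroup_algebra_indicator[OF S] by auto
  then have "(\<Sum>s\<in>carrier A. of_int (of_bool (s \<in> S)) * \<chi> s) = (\<Sum>s\<in>S. \<chi> s)"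
    by (intro sum.mono_neutral_cong_right) auto
  then show ?thesis using weighted[OF span] by simp
qed

end

section \<open>Eigenvalues of Cayley graphs\<close>

text \<open>Vectors indexed by the enumeration \<open>vs\<close> correspond to functions on the
  vertices, so the enumeration drops out of the spectrum.\<close>

lemma eigenvalue_adjacency_matrix_iff:
  assumes vs: "distinct vs"
  shows "eigenvalue (adjacency_matrix vs E) k \<longleftrightarrow>
    (\<exists>f. (\<exists>g\<in>set vs. f g \<noteq> 0) \<and> (\<forall>g\<in>set vs. (\<Sum>h | h \<in> set vs \<and> {g, h} \<in> E. f h) = k * f g))"
    (is "?L \<longleftrightarrow> ?R")
proof -
  define n where "n = length vs"
  define M where "M = adjacency_matrix vs E"
  have M: "dim_row M = n" "dim_col M = n" by (simp_all add: M_def adjacency_matrix_def n_def)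
  have bij: "bij_betw (nth vs) {..<n} (set vs)" using vs by (intro bij_betw_nth) (auto simp: n_def)
  have row: "(M *\<^sub>v vec n (\<lambda>i. f (vs ! i))) $ i = (\<Sum>h | h \<in> set vs \<and> {vs ! i, h} \<in> E. f h)"
    if i: "i < n" for f i
  proof -
    have "(M *\<^sub>v vec n (\<lambda>i. f (vs ! i))) $ i = (\<Sum>j<n. if {vs ! i, vs ! j} \<in> E then f (vs ! j) else 0)"
      using i by (auto simp: M_def adjacency_matrix_def n_def scalar_prod_def atLeast0LessThan intro!: sum.cong)
    also have "\<dots> = (\<Sum>h\<in>set vs. if {vs ! i, h} \<in> E then f h else 0)"
      by (rule sum.reindex_bij_betw[OF bij])
    also have "\<dots> = (\<Sum>h | h \<in> set vs \<and> {vs ! i, h} \<in> E. f h)"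
      by (simp add: sum.inter_filter)
    finally show ?thesis .
  qed
  have ev: "eigenvector M (vec n (\<lambda>i. f (vs ! i))) k \<longleftrightarrow>
      (\<exists>g\<in>set vs. f g \<noteq> 0) \<and> (\<forall>g\<in>set vs. (\<Sum>h | h \<in> set vs \<and> {g, h} \<in> E. f h) = k * f g)" for f
  proof -
    have "vec n (\<lambda>i. f (vs ! i)) = 0\<^sub>v n \<longleftrightarrow> (\<forall>g\<in>set vs. f g = 0)"
      by (simp add: vec_eq_iff all_set_conv_all_nth n_def)
    moreover have "M *\<^sub>v vec n (\<lambda>i. f (vs ! i)) = k \<cdot>\<^sub>v vec n (\<lambda>i. f (vs ! i)) \<longleftrightarrow>
        (\<forall>i<n. (\<Sum>h | h \<in> set vs \<and> {vs ! i, h} \<in> E. f h) = k * f (vs ! i))"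
      unfolding vec_eq_iff using row M by (simp del: index_mult_mat_vec)
    moreover have "\<dots> \<longleftrightarrow> (\<forall>g\<in>set vs. (\<Sum>h | h \<in> set vs \<and> {g, h} \<in> E. f h) = k * f g)"
      by (simp add: all_set_conv_all_nth n_def)
    ultimately show ?thesis by (simp only: eigenvector_def M vec_carrier) blast
  qed
  have "\<exists>f. v = vec n (\<lambda>i. f (vs ! i))" if "eigenvector M v k" for v
  proof -
    have "v \<in> carrier_vec n" using that by (simp add: eigenvector_def M)
    then have "v = vec n (\<lambda>i. v $ (inv_into {..<n} (nth vs) (vs ! i)))"
      using bij by (intro eq_vecI) (auto simp: bij_betw_inv_into_left)
    then show ?thesis by (intro exI[of _ "\<lambda>g. v $ (inv_into {..<n} (nth vs) g)"])
  qed
  then have "eigenvalue M k \<longleftrightarrow> (\<exists>f. eigenvector M (vec n (\<lambda>i. f (vs ! i))) k)"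
    unfolding eigenvalue_def by fastforce
  then show ?thesis unfolding M_def[symmetric] ev .
qed

text \<open>The neighbours of \<open>g\<close> are the products of \<open>g\<close> with the
  elements of \<open>S\<close>, so the adjacency operator sums over right translates.\<close>

lemma integral_Cayley_graph_iff:
  assumes G: "group G" "finite (carrier G)" and S: "S \<subseteq> carrier G" "set_inv\<^bsub>G\<^esub> S = S"
  shows "integral_graph (Cayley_graph G S) \<longleftrightarrow>
    (\<forall>k f. (\<exists>g\<in>carrier G. f g \<noteq> 0) \<longrightarrow>
      (\<forall>g\<in>carrier G. (\<Sum>s\<in>S. f (g \<otimes>\<^bsub>G\<^esub> s)) = k * f g) \<longrightarrow> (k::complex) \<in> \<int>)"
proof -
  interpret group G by (rule G)
  define E where "E = snd (Cayley_graph G S)"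
  have inv_S: "inv\<^bsub>G\<^esub> s \<in> S" if "s \<in> S" for s
    using S(2) that by (auto simp: SET_INV_def)
  \<comment> \<open>An edge is an unordered pair and may arise from either orientation; closure of
    \<open>S\<close> under inverses converts one into the other.\<close>
  have E: "{g, h} \<in> E \<longleftrightarrow> inv\<^bsub>G\<^esub> g \<otimes>\<^bsub>G\<^esub> h \<in> S" if gh: "g \<in> carrier G" "h \<in> carrier G" for g h
  proof
    assume "{g, h} \<in> E"
    then have "inv\<^bsub>G\<^esub> g \<otimes>\<^bsub>G\<^esub> h \<in> S \<or> inv\<^bsub>G\<^esub> h \<otimes>\<^bsub>G\<^esub> g \<in> S"
      by (auto simp: E_def Cayley_graph_def doubleton_eq_iff)
    moreover have "inv\<^bsub>G\<^esub> (inv\<^bsub>G\<^esub> h \<otimes>\<^bsub>G\<^esub> g) = inv\<^bsub>G\<^esub> g \<otimes>\<^bsub>G\<^esub> h"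
      using gh by (simp add: inv_mult_group)
    ultimately show "inv\<^bsub>G\<^esub> g \<otimes>\<^bsub>G\<^esub> h \<in> S" using inv_S by metis
  qed (use gh in \<open>auto simp: E_def Cayley_graph_def\<close>)
  have sum_E: "(\<Sum>h | h \<in> carrier G \<and> {g, h} \<in> E. f h) = (\<Sum>s\<in>S. f (g \<otimes>\<^bsub>G\<^esub> s))"
    if g: "g \<in> carrier G" for g and f :: "_ \<Rightarrow> complex"
  proof (rule sum.reindex_bij_witness[of _ "\<lambda>s. g \<otimes>\<^bsub>G\<^esub> s" "\<lambda>h. inv\<^bsub>G\<^esub> g \<otimes>\<^bsub>G\<^esub> h"])
    fix s assume s: "s \<in> S"
    then have "s \<in> carrier G" using S by auto
    then show "g \<otimes>\<^bsub>G\<^esub> s \<in> {h. h \<in> carrier G \<and> {g, h} \<in> E}" "inv\<^bsub>G\<^esub> g \<otimes>\<^bsub>G\<^esub> (g \<otimes>\<^bsub>G\<^esub> s) = s"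
      using g s E[of g "g \<otimes>\<^bsub>G\<^esub> s"] by (auto simp: m_assoc[symmetric])
  next
    fix h assume "h \<in> {h. h \<in> carrier G \<and> {g, h} \<in> E}"
    then have h: "h \<in> carrier G" "{g, h} \<in> E" by auto
    then show "inv\<^bsub>G\<^esub> g \<otimes>\<^bsub>G\<^esub> h \<in> S" "g \<otimes>\<^bsub>G\<^esub> (inv\<^bsub>G\<^esub> g \<otimes>\<^bsub>G\<^esub> h) = h"
      "f (g \<otimes>\<^bsub>G\<^esub> (inv\<^bsub>G\<^esub> g \<otimes>\<^bsub>G\<^esub> h)) = f h"
      using g E[of g h] by (auto simp: m_assoc[symmetric])
  qed
  have ev: "eigenvalue (adjacency_matrix vs E) k \<longleftrightarrow> (\<exists>f. (\<exists>g\<in>carrier G. f g \<noteq> 0) \<and>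
      (\<forall>g\<in>carrier G. (\<Sum>s\<in>S. f (g \<otimes>\<^bsub>G\<^esub> s)) = k * f g))"
    if "distinct vs" "set vs = carrier G" for vs k
    using that by (simp add: eigenvalue_adjacency_matrix_iff sum_E)
  obtain vs where vs: "distinct vs" "set vs = carrier G"
    using finite_distinct_list[OF G(2)] by auto
  have fst: "fst (Cayley_graph G S) = carrier G" by (simp add: Cayley_graph_def)
  show ?thesis
    unfolding integral_graph_def E_def[symmetric] fst
  proof (intro iffI allI impI)
    fix k :: complex and f
    assume "\<forall>vs. distinct vs \<and> set vs = carrier G \<longrightarrow>
        (\<forall>k. eigenvalue (adjacency_matrix vs E) k \<longrightarrow> k \<in> \<int>)"
      and "\<exists>g\<in>carrier G. f g \<noteq> 0" "\<forall>g\<in>carrier G. (\<Sum>s\<in>S. f (g \<otimes>\<^bsub>G\<^esub> s)) = k * f g"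
    then show "k \<in> \<int>" using ev[OF vs] vs by blast
  next
    fix vs and k :: complex
    assume *: "\<forall>k f. (\<exists>g\<in>carrier G. f g \<noteq> 0) \<longrightarrow>
        (\<forall>g\<in>carrier G. (\<Sum>s\<in>S. f (g \<otimes>\<^bsub>G\<^esub> s)) = k * f g) \<longrightarrow> (k::complex) \<in> \<int>"
      and "distinct vs \<and> set vs = carrier G" "eigenvalue (adjacency_matrix vs E) k"
    then obtain f where "\<exists>g\<in>carrier G. f g \<noteq> 0"
        "\<forall>g\<in>carrier G. (\<Sum>s\<in>S. f (g \<otimes>\<^bsub>G\<^esub> s)) = k * f g"
      using ev by blast
    then show "k \<in> \<int>" using * by blast
  qed
qed

context finite_comm_group
begin

section \<open>Fourier transforms of convolutions\<close>

lemma char_sum_set_inv: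
  assumes \<chi>: "\<chi> \<in> hom A complex_units" and S: "S \<subseteq> carrier A"
  shows "(\<Sum>s\<in>set_inv S. \<chi> s) = cnj (\<Sum>s\<in>S. \<chi> s)"
proof -
  have "set_inv S = (\<lambda>s. inv s) ` S" by (auto simp: SET_INV_def)
  moreover have "inj_on (\<lambda>s. inv s) S" using inv_inj S by (rule inj_on_subset)
  ultimately have "(\<Sum>s\<in>set_inv S. \<chi> s) = (\<Sum>s\<in>S. \<chi> (inv s))" by (simp add: sum.reindex)
  also have "\<dots> = cnj (\<Sum>s\<in>S. \<chi> s)"
    unfolding cnj_sum using S \<chi> by (intro sum.cong) (auto simp: char_inv_cnj)
  finally show ?thesis .
qed

lemma char_comp_inv:
  assumes \<chi>: "\<chi> \<in> hom A complex_units"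
  shows "(\<lambda>x. \<chi> (inv x)) \<in> hom A complex_units"
  using char_nonzero[OF \<chi>] char_mult[OF \<chi>]
  by (auto intro!: homI simp: complex_units_def inv_mult)

lemma fourier_convolve:
  assumes \<chi>: "\<chi> \<in> hom A complex_units" and S: "S \<subseteq> carrier A"
  shows "fourier (\<lambda>a. \<Sum>s\<in>S. f (a \<otimes> s)) \<chi> = (\<Sum>s\<in>S. \<chi> s) * fourier f \<chi>"
proof -
  have "fourier (\<lambda>a. \<Sum>s\<in>S. f (a \<otimes> s)) \<chi> = (\<Sum>s\<in>S. fourier (\<lambda>a. f (a \<otimes> s)) \<chi>)"
    unfolding fourier_def sum_distrib_right by (rule sum.swap)
  also have "\<dots> = (\<Sum>s\<in>S. \<chi> s * fourier f \<chi>)"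
  proof (intro sum.cong refl)
    fix s assume "s \<in> S"
    then have s: "s \<in> carrier A" using S by auto
    have "fourier (\<lambda>a. f (a \<otimes> s)) \<chi> = fourier (\<lambda>a. f (s \<otimes> a)) \<chi>"
      unfolding fourier_def by (intro sum.cong) (use s in \<open>auto simp: m_comm\<close>)
    then show "fourier (\<lambda>a. f (a \<otimes> s)) \<chi> = \<chi> s * fourier f \<chi>"
      using fourier_translate[OF \<chi> s] by simp
  qed
  finally show ?thesis by (simp add: sum_distrib_right)
qed

lemma fourier_comp_inv:
  "fourier (\<lambda>a. f (inv a)) \<chi> = fourier f (\<lambda>x. \<chi> (inv x))"
  unfolding fourier_def
  by (rule sum.reindex_bij_witness[of _ "\<lambda>x. inv x" "\<lambda>x. inv x"]) auto

text \<open>Moving \<open>a\<close> past \<open>x\<close> inverts it, so the part of the operator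
  exchanging the cosets \<open>A\<close> and \<open>x A\<close> involves a reflection. The
  reflection pairs \<open>\<chi>\<close> with its inverse character.\<close>

lemma fourier_reflected_convolve:
  assumes \<chi>: "\<chi> \<in> hom A complex_units" and S: "S \<subseteq> carrier A"
  shows "fourier (\<lambda>a. \<Sum>s\<in>S. f (inv a \<otimes> s)) \<chi> =
    cnj (\<Sum>s\<in>S. \<chi> s) * fourier f (\<lambda>x. \<chi> (inv x))"
proof -
  have "(\<Sum>s\<in>S. \<chi> (inv s)) = cnj (\<Sum>s\<in>S. \<chi> s)"
    unfolding cnj_sum using S \<chi> by (intro sum.cong) (auto simp: char_inv_cnj)
  then show ?thesis
    unfolding fourier_comp_inv[of "\<lambda>b. \<Sum>s\<in>S. f (b \<otimes> s)"]
    using fourier_convolve[OF char_comp_inv[OF \<chi>] S, of f] by simp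
qed

end

section \<open>The spectrum of the Cayley graph of the dicyclic group\<close>

text \<open>The last two assumptions express that the connection set is closed under inverses: the
  inverse of \<open>x s\<close> is \<open>x y s\<close>.\<close>

locale dic_connection_set = finite_comm_group +
  fixes y S1 S2
  assumes y: "y \<in> carrier A" "y \<otimes> y = \<one>"
    and S1: "S1 \<subseteq> carrier A" and S2: "S2 \<subseteq> carrier A"
    and inv_S1: "set_inv S1 = S1"
    and y_S2: "\<And>s. s \<in> S2 \<Longrightarrow> y \<otimes> s \<in> S2"
begin

lemma sum_S2_translate: "(\<Sum>s\<in>S2. f (y \<otimes> s)) = (\<Sum>s\<in>S2. f s :: complex)"
  by (rule sum.reindex_bij_witness[of _ "\<lambda>s. y \<otimes> s" "\<lambda>s. y \<otimes> s"])
    (use y y_S2 S2 in \<open>auto simp: m_assoc[symmetric] subset_iff\<close>)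

lemma sum_S1_real: "\<chi> \<in> hom A complex_units \<Longrightarrow> cnj (\<Sum>s\<in>S1. \<chi> s) = (\<Sum>s\<in>S1. \<chi> s)"
  using char_sum_set_inv[OF _ S1] inv_S1 by metis

abbreviation connection_set :: "('a + 'a) set" where
  "connection_set \<equiv> Inl ` S1 \<union> Inr ` S2"

text \<open>The equation splits along the cosets \<open>A\<close> and \<open>x A\<close>. The factor
  \<open>y\<close> in the product of two elements of \<open>x A\<close> disappears because
  translation by \<open>y\<close> permutes \<open>S2\<close>.\<close>

lemma Dic_eigenfunction_iff:
  "(\<forall>g\<in>carrier (Dic A y). (\<Sum>s\<in>connection_set. f (g \<otimes>\<^bsub>Dic A y\<^esub> s)) = k * f g) \<longleftrightarrow>
    (\<forall>a\<in>carrier A. (\<Sum>s\<in>S1. f (Inl (a \<otimes> s))) + (\<Sum>s\<in>S2. f (Inr (inv a \<otimes> s))) = k * f (Inl a)) \<and>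
    (\<forall>a\<in>carrier A. (\<Sum>s\<in>S1. f (Inr (a \<otimes> s))) + (\<Sum>s\<in>S2. f (Inl (inv a \<otimes> s))) = (k::complex) * f (Inr a))"
proof -
  have fin: "finite S1" "finite S2" using S1 S2 finite_subset finite_carrier by blast+
  have split: "(\<Sum>s\<in>connection_set. h s) = (\<Sum>s\<in>S1. h (Inl s)) + (\<Sum>s\<in>S2. h (Inr s))"
    for h :: "_ \<Rightarrow> complex"
    using fin by (subst sum.union_disjoint) (auto simp: sum.reindex)
  have "(\<Sum>s\<in>S2. f (Inl (y \<otimes> (inv a \<otimes> s)))) = (\<Sum>s\<in>S2. f (Inl (inv a \<otimes> s)))"
    if a: "a \<in> carrier A" for a
  proof -
    have "(\<Sum>s\<in>S2. f (Inl (y \<otimes> (inv a \<otimes> s)))) = (\<Sum>s\<in>S2. f (Inl (inv a \<otimes> (y \<otimes> s))))"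
      by (intro sum.cong refl) (use a y S2 in \<open>auto simp: m_lcomm subset_iff\<close>)
    then show ?thesis using sum_S2_translate[of "\<lambda>s. f (Inl (inv a \<otimes> s))"] by simp
  qed
  then show ?thesis by (auto simp: Dic_def split ball_Un)
qed

text \<open>On the plane of \<open>\<chi>\<close> the operator is a 2 by 2 matrix with
  \<open>\<sigma>\<close> on the diagonal and \<open>cnj \<tau>\<close> and \<open>\<tau>\<close>
  off it; the equation for \<open>k\<close> is its characteristic equation.\<close>

lemma Dic_eigenvalue_iff:
  "(\<exists>f. (\<exists>g\<in>carrier (Dic A y). f g \<noteq> 0) \<and>
      (\<forall>g\<in>carrier (Dic A y). (\<Sum>s\<in>connection_set. f (g \<otimes>\<^bsub>Dic A y\<^esub> s)) = k * f g)) \<longleftrightarrow>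
    (\<exists>\<chi>\<in>hom A complex_units. (k - (\<Sum>s\<in>S1. \<chi> s))\<^sup>2 = (\<Sum>s\<in>S2. \<chi> s) * cnj (\<Sum>s\<in>S2. \<chi> s))"
    (is "?L \<longleftrightarrow> ?R")
proof
  assume ?L
  then obtain f where nz: "\<exists>g\<in>carrier (Dic A y). f g \<noteq> 0"
    and "\<forall>g\<in>carrier (Dic A y). (\<Sum>s\<in>connection_set. f (g \<otimes>\<^bsub>Dic A y\<^esub> s)) = k * f g"
    by blast
  then have 1: "\<And>a. a \<in> carrier A \<Longrightarrow>
      (\<Sum>s\<in>S1. f (Inl (a \<otimes> s))) + (\<Sum>s\<in>S2. f (Inr (inv a \<otimes> s))) = k * f (Inl a)"
    and 2: "\<And>a. a \<in> carrier A \<Longrightarrow>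
      (\<Sum>s\<in>S1. f (Inr (a \<otimes> s))) + (\<Sum>s\<in>S2. f (Inl (inv a \<otimes> s))) = k * f (Inr a)"
    unfolding Dic_eigenfunction_iff by auto
  define p where "p a = f (Inl a)" for a
  define q where "q a = f (Inr a)" for a
  have pq: "\<exists>\<chi>\<in>hom A complex_units. fourier p \<chi> \<noteq> 0 \<or> fourier q \<chi> \<noteq> 0"
    using nz fourier_injective[of p] fourier_injective[of q] by (auto simp: Dic_def p_def q_def)
  \<comment> \<open>The coefficient of \<open>p\<close> at \<open>\<chi>\<close> is coupled to that
    of \<open>q\<close> at the inverse character. If only \<open>q\<close> has a nonzero coefficient
    at the given character, its inverse is taken.\<close>
  have "\<exists>\<chi>\<in>hom A complex_units. fourier p \<chi> \<noteq> 0 \<or> fourier q (\<lambda>x. \<chi> (inv x)) \<noteq> 0"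
  proof -
    have "fourier q (\<lambda>x. \<chi> (inv (inv x))) = fourier q \<chi>" for \<chi>
      by (simp add: fourier_def)
    moreover obtain \<chi> where "\<chi> \<in> hom A complex_units" "fourier p \<chi> \<noteq> 0 \<or> fourier q \<chi> \<noteq> 0"
      using pq by blast
    ultimately show ?thesis
      using bexI[of _ "\<lambda>x. \<chi> (inv x)" "hom A complex_units"] char_comp_inv[of \<chi>] by fastforce
  qed
  then obtain \<chi> where \<chi>: "\<chi> \<in> hom A complex_units"
    and PQ: "fourier p \<chi> \<noteq> 0 \<or> fourier q (\<lambda>x. \<chi> (inv x)) \<noteq> 0" by blast
  define \<chi>' where "\<chi>' = (\<lambda>x. \<chi> (inv x))"
  have \<chi>': "\<chi>' \<in> hom A complex_units" unfolding \<chi>'_def by (rule char_comp_inv[OF \<chi>])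
  define P where "P = fourier p \<chi>"
  define Q where "Q = fourier q \<chi>'"
  define \<sigma> where "\<sigma> = (\<Sum>s\<in>S1. \<chi> s)"
  define \<tau> where "\<tau> = (\<Sum>s\<in>S2. \<chi> s)"
  have sums: "(\<Sum>s\<in>S1. \<chi>' s) = \<sigma>" "(\<Sum>s\<in>S2. \<chi>' s) = cnj \<tau>"
  proof -
    have "(\<Sum>s\<in>T. \<chi>' s) = cnj (\<Sum>s\<in>T. \<chi> s)" if "T \<subseteq> carrier A" for T
      unfolding cnj_sum \<chi>'_def using that \<chi> by (intro sum.cong) (auto simp: char_inv_cnj)
    then show "(\<Sum>s\<in>S1. \<chi>' s) = \<sigma>" "(\<Sum>s\<in>S2. \<chi>' s) = cnj \<tau>"
      using S1 S2 sum_S1_real[OF \<chi>] by (simp_all add: \<sigma>_def \<tau>_def)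
  qed
  have add: "fourier (\<lambda>a. g a + h a) \<psi> = fourier g \<psi> + fourier h \<psi>" for g h \<psi>
    using fourier_linear[of 1 g h] by simp
  have scale: "fourier (\<lambda>a. k * g a) \<psi> = k * fourier g \<psi>" for g \<psi>
    by (simp add: fourier_def sum_distrib_left mult.assoc)
  have "fourier (\<lambda>a. (\<Sum>s\<in>S1. p (a \<otimes> s)) + (\<Sum>s\<in>S2. q (inv a \<otimes> s))) \<chi> = fourier (\<lambda>a. k * p a) \<chi>"
    unfolding fourier_def using 1 by (intro sum.cong) (auto simp: p_def q_def)
  then have eq1: "\<sigma> * P + cnj \<tau> * Q = k * P"
    unfolding add scale fourier_convolve[OF \<chi> S1] fourier_reflected_convolve[OF \<chi> S2]
    by (simp add: P_def Q_def \<sigma>_def \<tau>_def \<chi>'_def)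
  have "fourier p (\<lambda>x. \<chi>' (inv x)) = P" by (simp add: P_def \<chi>'_def fourier_def)
  moreover have "fourier (\<lambda>a. (\<Sum>s\<in>S1. q (a \<otimes> s)) + (\<Sum>s\<in>S2. p (inv a \<otimes> s))) \<chi>' = fourier (\<lambda>a. k * q a) \<chi>'"
    unfolding fourier_def using 2 by (intro sum.cong) (auto simp: p_def q_def)
  ultimately have eq2: "\<sigma> * Q + \<tau> * P = k * Q"
    unfolding add scale fourier_convolve[OF \<chi>' S1] fourier_reflected_convolve[OF \<chi>' S2] sums
    by (simp add: Q_def)
  have kP: "(k - \<sigma>) * P = cnj \<tau> * Q" and kQ: "(k - \<sigma>) * Q = \<tau> * P"
    using eq1 eq2 by (simp_all add: algebra_simps)
  \<comment> \<open>Applying \<open>kP\<close> and \<open>kQ\<close> in turn shows that both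
    \<open>P\<close> and \<open>Q\<close> are annihilated by the characteristic polynomial at
    \<open>k\<close>; one of them is nonzero.\<close>
  have "(k - \<sigma>)\<^sup>2 * P = (k - \<sigma>) * ((k - \<sigma>) * P)" by (simp add: power2_eq_square)
  also have "\<dots> = cnj \<tau> * ((k - \<sigma>) * Q)" unfolding kP by (simp only: mult.left_commute)
  finally have "(k - \<sigma>)\<^sup>2 * P = \<tau> * cnj \<tau> * P" unfolding kQ by (simp only: mult_ac)
  moreover have "(k - \<sigma>)\<^sup>2 * Q = (k - \<sigma>) * ((k - \<sigma>) * Q)" by (simp add: power2_eq_square)
  then have "(k - \<sigma>)\<^sup>2 * Q = \<tau> * ((k - \<sigma>) * P)" unfolding kQ by (simp only: mult.left_commute)
  then have "(k - \<sigma>)\<^sup>2 * Q = \<tau> * cnj \<tau> * Q" unfolding kP by (simp only: mult_ac)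
  ultimately have "(k - \<sigma>)\<^sup>2 = \<tau> * cnj \<tau>" using PQ by (auto simp: P_def Q_def \<chi>'_def)
  then show ?R using \<chi> by (auto simp: \<sigma>_def \<tau>_def)
next
  assume ?R
  then obtain \<chi> where \<chi>: "\<chi> \<in> hom A complex_units"
    and k: "(k - (\<Sum>s\<in>S1. \<chi> s))\<^sup>2 = (\<Sum>s\<in>S2. \<chi> s) * cnj (\<Sum>s\<in>S2. \<chi> s)" by blast
  define \<sigma> where "\<sigma> = (\<Sum>s\<in>S1. \<chi> s)"
  define \<tau> where "\<tau> = (\<Sum>s\<in>S2. \<chi> s)"
  have k: "(k - \<sigma>)\<^sup>2 = \<tau> * cnj \<tau>" using k by (simp add: \<sigma>_def \<tau>_def)
  \<comment> \<open>An eigenvector of the 2 by 2 matrix with \<open>c \<noteq> 0\<close>, so that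
    \<open>f\<close> is nonzero at \<open>Inl \<one>\<close>. For \<open>\<tau> = 0\<close> the
    general choice \<open>cnj \<tau>\<close> of \<open>c\<close> would vanish.\<close>
  obtain c d where c: "c \<noteq> 0" and cd: "c * \<sigma> + d * cnj \<tau> = k * c" "d * \<sigma> + c * \<tau> = k * d"
  proof (cases "\<tau> = 0")
    case True
    then have "k = \<sigma>" using k by simp
    then show ?thesis using that[of 1 0] True by simp
  next
    case False
    have "(k - \<sigma>) * \<sigma> + cnj \<tau> * \<tau> = k * (k - \<sigma>)"
      using k by (simp add: power2_eq_square algebra_simps)
    then show ?thesis using that[of "cnj \<tau>" "k - \<sigma>"] False by (simp add: algebra_simps)
  qed
  define f where "f = case_sum (\<lambda>a. c * \<chi> a) (\<lambda>a. d * \<chi> (inv a))"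
  have cnj_sum': "(\<Sum>s\<in>T. \<chi> (inv s)) = cnj (\<Sum>s\<in>T. \<chi> s)" if "T \<subseteq> carrier A" for T
    unfolding cnj_sum using that \<chi> by (intro sum.cong) (auto simp: char_inv_cnj)
  have sums: "(\<Sum>s\<in>T. \<chi> (a \<otimes> s)) = \<chi> a * (\<Sum>s\<in>T. \<chi> s)"
    "(\<Sum>s\<in>T. \<chi> (inv (a \<otimes> s))) = \<chi> (inv a) * cnj (\<Sum>s\<in>T. \<chi> s)"
    if "T \<subseteq> carrier A" "a \<in> carrier A" for a T
    unfolding cnj_sum'[OF that(1), symmetric] sum_distrib_left
    by (intro sum.cong refl; use that \<chi> in \<open>auto simp: char_mult inv_mult subset_iff\<close>)+
  have "\<forall>g\<in>carrier (Dic A y). (\<Sum>s\<in>connection_set. f (g \<otimes>\<^bsub>Dic A y\<^esub> s)) = k * f g"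
    unfolding Dic_eigenfunction_iff
  proof (intro conjI ballI)
    fix a assume a: "a \<in> carrier A"
    have "(\<Sum>s\<in>S1. f (Inl (a \<otimes> s))) + (\<Sum>s\<in>S2. f (Inr (inv a \<otimes> s))) = \<chi> a * (c * \<sigma> + d * cnj \<tau>)"
      using sums(1)[OF S1 a] sums(2)[OF S2, of "inv a"] a
      by (simp add: f_def sum_distrib_left[symmetric] \<sigma>_def \<tau>_def algebra_simps del: cnj_sum)
    then show "(\<Sum>s\<in>S1. f (Inl (a \<otimes> s))) + (\<Sum>s\<in>S2. f (Inr (inv a \<otimes> s))) = k * f (Inl a)"
      by (simp add: cd f_def)
    have "(\<Sum>s\<in>S1. f (Inr (a \<otimes> s))) + (\<Sum>s\<in>S2. f (Inl (inv a \<otimes> s))) = \<chi> (inv a) * (d * \<sigma> + c * \<tau>)"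
      using sums(2)[OF S1 a] sums(1)[OF S2, of "inv a"] a sum_S1_real[OF \<chi>]
      by (simp add: f_def sum_distrib_left[symmetric] \<sigma>_def \<tau>_def algebra_simps del: cnj_sum)
    then show "(\<Sum>s\<in>S1. f (Inr (a \<otimes> s))) + (\<Sum>s\<in>S2. f (Inl (inv a \<otimes> s))) = k * f (Inr a)"
      by (simp add: cd f_def)
  qed
  moreover have "f (Inl \<one>) \<noteq> 0" using c \<chi> by (simp add: f_def char_one)
  moreover have "Inl \<one> \<in> carrier (Dic A y)" by (auto simp: Dic_def)
  ultimately show ?L by blast
qed

section \<open>Integrality of the spectrum\<close>

theorem integral_eigenvalues_iff:
  "(\<forall>\<chi>\<in>hom A complex_units. \<forall>k.
      (k - (\<Sum>s\<in>S1. \<chi> s))\<^sup>2 = (\<Sum>s\<in>S2. \<chi> s) * cnj (\<Sum>s\<in>S2. \<chi> s) \<longrightarrow> k \<in> \<int>) \<longleftrightarrow>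
    S1 \<in> subgroup_algebra A \<and>
    (\<forall>\<chi>\<in>hom A complex_units. \<not> squares A \<subseteq> kernel A complex_units \<chi> \<longrightarrow>
       (\<exists>\<alpha>::int. (\<Sum>s\<in>S2. \<chi> s) * cnj (\<Sum>s\<in>S2. \<chi> s) = (of_int \<alpha>)\<^sup>2))"
    (is "?L \<longleftrightarrow> ?R")
proof
  assume L: ?L
  have "(\<Sum>s\<in>S1. \<chi> s) \<in> \<int> \<and> of_real (norm (\<Sum>s\<in>S2. \<chi> s)) \<in> (\<int> :: complex set)"
    if \<chi>: "\<chi> \<in> hom A complex_units" for \<chi>
  proof -
    define \<sigma> where "\<sigma> = (\<Sum>s\<in>S1. \<chi> s)"
    define r where "r = complex_of_real (norm (\<Sum>s\<in>S2. \<chi> s))"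
    have r: "r\<^sup>2 = (\<Sum>s\<in>S2. \<chi> s) * cnj (\<Sum>s\<in>S2. \<chi> s)"
      unfolding r_def of_real_power[symmetric] by (rule complex_norm_square)
    \<comment> \<open>Both signs solve the quadratic equation for \<open>k\<close>. Their sum shows
      that \<open>\<sigma>\<close> is rational, and an algebraic integer that is rational is an
      integer.\<close>
    have "\<sigma> + r \<in> \<int>" "\<sigma> - r \<in> \<int>"
      using L[rule_format, OF \<chi>, of "\<sigma> + r"] L[rule_format, OF \<chi>, of "\<sigma> - r"] r
      by (simp_all add: \<sigma>_def del: cnj_sum)
    then have "(\<sigma> + r) + (\<sigma> - r) \<in> \<int>" by (rule Ints_add)
    then obtain m where "(\<sigma> + r) + (\<sigma> - r) = of_int m" by (rule Ints_cases)
    then have "\<sigma> = of_int m / of_int 2" by (simp add: mult.commute)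
    then have "\<sigma> \<in> \<rat>" by (metis Rats_divide Rats_of_int)
    then have "\<sigma> \<in> \<int>"
      using char_sum_algebraic_int[OF \<chi> S1] rational_algebraic_int_is_int by (auto simp: \<sigma>_def)
    moreover have "r \<in> \<int>" using Ints_diff[OF \<open>\<sigma> + r \<in> \<int>\<close> \<open>\<sigma> \<in> \<int>\<close>] by simp
    ultimately show ?thesis by (simp add: \<sigma>_def r_def)
  qed
  note int = this
  show ?R
  proof (intro conjI ballI impI)
    show "S1 \<in> subgroup_algebra A"
      using int by (intro integral_char_sums_imp_subgroup_algebra S1) blast
    fix \<chi> assume "\<chi> \<in> hom A complex_units"
    then obtain \<alpha> where "complex_of_real (norm (\<Sum>s\<in>S2. \<chi> s)) = of_int \<alpha>"
      using int by (blast elim: Ints_cases)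
    then show "\<exists>\<alpha>::int. (\<Sum>s\<in>S2. \<chi> s) * cnj (\<Sum>s\<in>S2. \<chi> s) = (of_int \<alpha>)\<^sup>2"
      by (metis complex_norm_square of_real_power)
  qed
next
  assume R: ?R
  show ?L
  proof (intro ballI allI impI)
    fix \<chi> k assume \<chi>: "\<chi> \<in> hom A complex_units"
      and k: "(k - (\<Sum>s\<in>S1. \<chi> s))\<^sup>2 = (\<Sum>s\<in>S2. \<chi> s) * cnj (\<Sum>s\<in>S2. \<chi> s)"
    have "\<exists>\<alpha>::int. (\<Sum>s\<in>S2. \<chi> s) * cnj (\<Sum>s\<in>S2. \<chi> s) = (of_int \<alpha>)\<^sup>2"
    proof (cases "squares A \<subseteq> kernel A complex_units \<chi>")
      case False
      then show ?thesis using R \<chi> by blast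
    next
      case True
      \<comment> \<open>A character trivial on squares has values 1 and -1, so its sum over
        \<open>S2\<close> is an integer and serves as \<open>\<alpha>\<close>.\<close>
      have "\<chi> a \<in> \<int>" if a: "a \<in> carrier A" for a
      proof -
        have "a [^] (2::nat) \<in> kernel A complex_units \<chi>" using True a by (auto simp: squares_def)
        then have "\<chi> a ^ 2 = 1" using char_pow[OF \<chi> a, of 2] by (simp add: kernel_def complex_units_def)
        then have "\<chi> a = 1 \<or> \<chi> a = -1" by (simp add: power2_eq_1_iff)
        then show ?thesis by auto
      qed
      then have "(\<Sum>s\<in>S2. \<chi> s) \<in> \<int>" using S2 by (intro Ints_sum) auto
      then obtain \<alpha> where "(\<Sum>s\<in>S2. \<chi> s) = of_int \<alpha>" by (rule Ints_cases)
      then show ?thesis by (auto simp: power2_eq_square simp del: cnj_sum)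
    qed
    then obtain \<alpha> :: int where "(k - (\<Sum>s\<in>S1. \<chi> s))\<^sup>2 = (of_int \<alpha>)\<^sup>2" using k by metis
    then have "k - (\<Sum>s\<in>S1. \<chi> s) = of_int \<alpha> \<or> k - (\<Sum>s\<in>S1. \<chi> s) = - of_int \<alpha>"
      by (simp only: power2_eq_iff)
    then have "k - (\<Sum>s\<in>S1. \<chi> s) \<in> \<int>" by auto
    then show "k \<in> \<int>"
      using Ints_add[OF _ subgroup_algebra_imp_integral_char_sum[OF conjunct1[OF R] \<chi>]] by force
  qed
qed

end

section \<open>The integrality criterion for generalized dicyclic groups\<close>

theorem theorem3p1:
  fixes A :: "('a, 'm) monoid_scheme" and y :: 'a
    and S :: "('a + 'a) set" and S1 S2 :: "'a set"
  assumes "comm_group A" and "finite (carrier A)" and "even (order A)"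
    and "group_exponent A \<ge> 3"
    and "y \<in> carrier A" and "group.ord A y = 2"
    and "S \<subseteq> carrier (Dic A y)"
    and "\<one>\<^bsub>Dic A y\<^esub> \<notin> S" and "set_inv\<^bsub>Dic A y\<^esub> S = S"
    and "S1 \<subseteq> carrier A" and "S2 \<subseteq> carrier A"
    and "S = dic_emb ` S1 \<union> (dic_x A <#\<^bsub>Dic A y\<^esub> dic_emb ` S2)"
  shows "integral_graph (Cayley_graph (Dic A y) S) \<longleftrightarrow>
    S1 \<in> subgroup_algebra A \<and>
    (\<forall>\<pi>\<in>hom A complex_units. \<not> squares A \<subseteq> kernel A complex_units \<pi> \<longrightarrow>
       (\<exists>\<alpha>::int. (\<Sum>s\<in>S2. \<pi> s) * (\<Sum>s\<in>set_inv\<^bsub>A\<^esub> S2. \<pi> s) = (of_int \<alpha>)\<^sup>2))"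
proof -
  interpret comm_group A by fact
  interpret finite_comm_group A by unfold_locales fact
  have y: "y \<in> carrier A" by fact
  have "y [^]\<^bsub>A\<^esub> (2::nat) = \<one>\<^bsub>A\<^esub>" using pow_ord_eq_1[OF y] \<open>group.ord A y = 2\<close> by simp
  then have yy: "y \<otimes>\<^bsub>A\<^esub> y = \<one>\<^bsub>A\<^esub>" using y by (simp add: numeral_2_eq_2)
  interpret D: group "Dic A y" by (rule group_Dic[OF \<open>comm_group A\<close> y yy])
  have S: "S = Inl ` S1 \<union> Inr ` S2"
    using assms(11) unfolding assms(12)
    by (auto simp: dic_emb_def dic_x_def l_coset_def Dic_def subset_iff image_iff)
  have inv_Inl: "inv\<^bsub>Dic A y\<^esub> (Inl a) = Inl (inv\<^bsub>A\<^esub> a)" if "a \<in> carrier A" for a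
    by (rule D.inv_equality) (use that in \<open>auto simp: Dic_def\<close>)
  have inv_Inr: "inv\<^bsub>Dic A y\<^esub> (Inr a) = Inr (y \<otimes>\<^bsub>A\<^esub> a)" if a: "a \<in> carrier A" for a
  proof (rule D.inv_equality)
    have "y \<otimes>\<^bsub>A\<^esub> (inv\<^bsub>A\<^esub> (y \<otimes>\<^bsub>A\<^esub> a) \<otimes>\<^bsub>A\<^esub> a) = \<one>\<^bsub>A\<^esub>"
      using a y yy by (simp add: inv_mult inv_y[OF \<open>comm_group A\<close> y yy] m_assoc)
    then show "Inr (y \<otimes>\<^bsub>A\<^esub> a) \<otimes>\<^bsub>Dic A y\<^esub> Inr a = \<one>\<^bsub>Dic A y\<^esub>" by (simp add: Dic_def)
  qed (use a y in \<open>auto simp: Dic_def\<close>)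
  have inv_S: "inv\<^bsub>Dic A y\<^esub> s \<in> S" if "s \<in> S" for s
    using assms(9) that by (auto simp: SET_INV_def)
  have inv_S1: "inv\<^bsub>A\<^esub> s \<in> S1" if "s \<in> S1" for s
    using inv_S[of "Inl s"] inv_Inl[of s] that assms(10) S by auto
  \<comment> \<open>Inversion maps \<open>Inr s\<close> to \<open>Inr (y \<otimes> s)\<close>, so
    closure of \<open>S\<close> under inverses makes \<open>S2\<close> stable under
    \<open>y\<close>.\<close>
  have y_S2: "y \<otimes>\<^bsub>A\<^esub> s \<in> S2" if "s \<in> S2" for s
    using inv_S[of "Inr s"] inv_Inr[of s] that assms(11) S by auto
  interpret dic_connection_set A y S1 S2
  proof unfold_locales
    show "set_inv\<^bsub>A\<^esub> S1 = S1"
    proof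
      show "set_inv\<^bsub>A\<^esub> S1 \<subseteq> S1" using inv_S1 by (auto simp: SET_INV_def)
      show "S1 \<subseteq> set_inv\<^bsub>A\<^esub> S1"
      proof
        fix s assume s: "s \<in> S1"
        then have "s = inv\<^bsub>A\<^esub> (inv\<^bsub>A\<^esub> s)" using assms(10) by auto
        then show "s \<in> set_inv\<^bsub>A\<^esub> S1" using inv_S1[OF s] by (auto simp: SET_INV_def)
      qed
    qed
  qed (use assms(10,11) y yy y_S2 in auto)
  have finD: "finite (carrier (Dic A y))" by (auto simp: Dic_def)
  have "integral_graph (Cayley_graph (Dic A y) S) \<longleftrightarrow>
    (\<forall>\<chi>\<in>hom A complex_units. \<forall>k.
      (k - (\<Sum>s\<in>S1. \<chi> s))\<^sup>2 = (\<Sum>s\<in>S2. \<chi> s) * cnj (\<Sum>s\<in>S2. \<chi> s) \<longrightarrow> k \<in> \<int>)"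
    unfolding integral_Cayley_graph_iff[OF D.group_axioms finD assms(7,9)]
    using Dic_eigenvalue_iff unfolding S by blast
  also note integral_eigenvalues_iff
  \<comment> \<open>The sum over the inverses of \<open>S2\<close> is the conjugate of the sum over
    \<open>S2\<close>.\<close>
  finally show ?thesis by (simp add: char_sum_set_inv[OF _ S2] del: cnj_sum cong: conj_cong)
qed

end
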